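(* For $0<\alpha\in\mathcal O_K$, its (finite) greedy expansion is the only element $x$ of $\mathcal O_\theta^+$ satisfying $\pi(x)=\pi(\alpha)$. In other words, $\pi^{-1}(\pi(\alpha))$ has a unique element in $\mathcal O_\theta^+$.
   Context: $\theta>1$ is a real quadratic unit with $N(\theta)=-1$, so $\theta^2=a\theta+1$ with an integer $a\ge1$; $K=\mathbb Q(\theta)\subset\mathbb R$, $\mathcal O_K$ its ring of integers. A greedy polynomial is a finite sum $\sum_{i=m}^M b_i\theta^i$ with $b_i\in\{0,\dots,a\}$ such that $b_i=a$ implies $b_{i-1}=0$; every nonzero $\alpha\in\mathcal O_K$ is uniquely $\pm$ such a sum with $b_m\ne0$ (its greedy expansion), and $|\alpha|_\theta:=\theta^{-m}$, $|0|_\theta=0$. $\widehat{\mathcal O}_\theta$ is the ring of sequences in $\mathcal O_K$ that are Cauchy for $|\cdot|_\theta$ modulo those with $|f_n|_\theta\to0$; $\mathcal O_K\subset\widehat{\mathcal O}_\theta$ via constant sequences. $\mathcal O_\theta^+$ is the set of greedy Laurent series $x=\sum_{i\ge m}b_i\theta^i$ (formal series with $b_i\in\{0,\dots,a\}$ all of whose truncations are greedy polynomials). A sequence $(x_n)$ in $\mathcal O_K$ is a sequence of partial sums of $x$ if there are integers $M_n$, nondecreasing, $M_n\to\infty$, with $x_n=\sum_{i=m}^{M_n}b_i\theta^i+\delta_n$, $\delta_n$ a greedy polynomial involving only powers $\theta^j$, $j>M_n$. All such sequences are Cauchy and define the same class $\pi(x)\in\widehat{\mathcal O}_\theta$. The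 set $\mathcal O_\theta=\mathcal O_\theta^+\cup(-\mathcal O_\theta^+)$ with $\pi(-x)=-\pi(x)$; a positive $\alpha\in\mathcal O_K$ is regarded as an element of $\mathcal O_\theta^+$ via its greedy expansion.
   Formalization: α is also assumed to lie in Z[θ] (automatic if O_K = Z[θ]), since other elements of O_K, e.g. (1+√5)/2 for θ = 2+√5, have no greedy expansion; |·|_θ, undefined on O_K outside Z[θ], is set to 1 there. *)

theory Defs
  imports Complex_Main "HOL-Computational_Algebra.Polynomial" "HOL-Algebra.QuotRing"
begin

text \<open>
  Throughout, \<open>a\<close> is the trace of \<open>\<theta>\<close>, and \<open>\<theta> > 1\<close> with \<open>\<theta>\<^sup>2 = a \<theta> + 1\<close>. A formal Laurent
  series \<open>\<Sum>i. b\<^sub>i \<theta>\<^sup>i\<close> is represented by its digit function \<open>b :: int \<Rightarrow> int\<close>.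
\<close>

subsection \<open>The number field and its integers\<close>

text \<open>As \<open>\<theta>\<close> is quadratic, \<open>\<rat>(\<theta>) = \<rat> + \<rat>\<theta>\<close> and \<open>\<int>[\<theta>] = \<int> + \<int>\<theta>\<close>.\<close>

definition quad_field :: "real \<Rightarrow> real set" where
  "quad_field \<theta> = {p + q * \<theta> | p q. p \<in> \<rat> \<and> q \<in> \<rat>}"

definition ring_of_integers :: "real \<Rightarrow> real set" where
  "ring_of_integers \<theta> = {x \<in> quad_field \<theta>. algebraic_int x}"

definition Z_adjoin :: "real \<Rightarrow> real set" where
  "Z_adjoin \<theta> = {p + q * \<theta> | p q. p \<in> \<int> \<and> q \<in> \<int>}"

subsection \<open>Greedy polynomials and greedy Laurent series\<close>

definition supp :: "(int \<Rightarrow> int) \<Rightarrow> int set" where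
  "supp b = {i. b i \<noteq> 0}"

definition greedy_poly :: "int \<Rightarrow> (int \<Rightarrow> int) \<Rightarrow> bool" where
  "greedy_poly a b \<longleftrightarrow> finite (supp b) \<and> (\<forall>i. b i \<in> {0..a} \<and> (b i = a \<longrightarrow> b (i - 1) = 0))"

definition eval_poly :: "real \<Rightarrow> (int \<Rightarrow> int) \<Rightarrow> real" where
  "eval_poly \<theta> b = (\<Sum>i\<in>supp b. of_int (b i) * \<theta> powi i)"

definition greedy_expands :: "int \<Rightarrow> real \<Rightarrow> (int \<Rightarrow> int) \<Rightarrow> real \<Rightarrow> bool" where
  "greedy_expands a \<theta> b \<alpha> \<longleftrightarrow> greedy_poly a b \<and> eval_poly \<theta> b = \<alpha>"

definition greedy_expansion :: "int \<Rightarrow> real \<Rightarrow> real \<Rightarrow> (int \<Rightarrow> int)" where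
  "greedy_expansion a \<theta> \<alpha> = (THE b. greedy_expands a \<theta> b \<alpha>)"

definition truncate :: "int \<Rightarrow> (int \<Rightarrow> int) \<Rightarrow> (int \<Rightarrow> int)" where
  "truncate M x = (\<lambda>i. if i \<le> M then x i else 0)"

definition O_plus :: "int \<Rightarrow> (int \<Rightarrow> int) set" where
  "O_plus a = {x. (\<exists>m. \<forall>i<m. x i = 0) \<and> (\<forall>M. greedy_poly a (truncate M x))}"

definition O_signed :: "int \<Rightarrow> (int \<Rightarrow> int) set" where
  "O_signed a = O_plus a \<union> (\<lambda>x i. - x i) ` O_plus a"

subsection \<open>The absolute value and the completion\<close>

text \<open>
  A greedy polynomial has a nonnegative value, so \<open>\<alpha>\<close> is plus or minus such a value exactly when
  \<open>\<bar>\<alpha>\<bar>\<close> is one. If \<open>ring_of_integers \<theta>\<close> is strictly larger than \<open>Z_adjoin \<theta>\<close> (e.g. for \<open>a = 4\<close>),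
  the elements outside \<open>Z_adjoin \<theta>\<close> have no greedy expansion; they get the value 1, so that no
  sequence of them tends to 0.
\<close>

definition theta_abs :: "int \<Rightarrow> real \<Rightarrow> real \<Rightarrow> real" where
  "theta_abs a \<theta> \<alpha> =
     (if \<alpha> = 0 then 0
      else if \<exists>b. greedy_expands a \<theta> b \<bar>\<alpha>\<bar>
           then \<theta> powi (- Min (supp (greedy_expansion a \<theta> \<bar>\<alpha>\<bar>)))
      else 1)"

definition cauchy_seqs :: "int \<Rightarrow> real \<Rightarrow> (nat \<Rightarrow> real) set" where
  "cauchy_seqs a \<theta> =
     {f. (\<forall>n. f n \<in> ring_of_integers \<theta>) \<and>
         (\<forall>\<epsilon>>0. \<exists>N. \<forall>m\<ge>N. \<forall>n\<ge>N. theta_abs a \<theta> (f m - f n) < \<epsilon>)}"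

definition null_seqs :: "int \<Rightarrow> real \<Rightarrow> (nat \<Rightarrow> real) set" where
  "null_seqs a \<theta> = {f \<in> cauchy_seqs a \<theta>. (\<lambda>n. theta_abs a \<theta> (f n)) \<longlonglongrightarrow> 0}"

definition cauchy_ring :: "int \<Rightarrow> real \<Rightarrow> (nat \<Rightarrow> real) ring" where
  "cauchy_ring a \<theta> =
     \<lparr>carrier = cauchy_seqs a \<theta>, mult = (\<lambda>f g n. f n * g n), one = (\<lambda>_. 1),
      zero = (\<lambda>_. 0), add = (\<lambda>f g n. f n + g n)\<rparr>"

definition O_hat :: "int \<Rightarrow> real \<Rightarrow> (nat \<Rightarrow> real) set ring" where
  "O_hat a \<theta> = cauchy_ring a \<theta> Quot null_seqs a \<theta>"

definition seq_class :: "int \<Rightarrow> real \<Rightarrow> (nat \<Rightarrow> real) \<Rightarrow> (nat \<Rightarrow> real) set" where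
  "seq_class a \<theta> f = null_seqs a \<theta> +>\<^bsub>cauchy_ring a \<theta>\<^esub> f"

definition const_class :: "int \<Rightarrow> real \<Rightarrow> real \<Rightarrow> (nat \<Rightarrow> real) set" where
  "const_class a \<theta> \<alpha> = seq_class a \<theta> (\<lambda>_. \<alpha>)"

subsection \<open>Sequences of partial sums and the projection\<close>

definition partial_sum_seq :: "int \<Rightarrow> real \<Rightarrow> (int \<Rightarrow> int) \<Rightarrow> (nat \<Rightarrow> real) \<Rightarrow> bool" where
  "partial_sum_seq a \<theta> x f \<longleftrightarrow>
     (\<forall>n. f n \<in> ring_of_integers \<theta>) \<and>
     (\<exists>M :: nat \<Rightarrow> int. mono M \<and> filterlim M at_top sequentially \<and>
        (\<forall>n. \<exists>d. greedy_poly a d \<and> (\<forall>j\<le>M n. d j = 0) \<and>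
              f n = eval_poly \<theta> (truncate (M n) x) + eval_poly \<theta> d))"

definition proj_plus :: "int \<Rightarrow> real \<Rightarrow> (int \<Rightarrow> int) \<Rightarrow> (nat \<Rightarrow> real) set" where
  "proj_plus a \<theta> x =
     (THE c. \<forall>f. partial_sum_seq a \<theta> x f \<longrightarrow> f \<in> cauchy_seqs a \<theta> \<and> seq_class a \<theta> f = c)"

definition proj :: "int \<Rightarrow> real \<Rightarrow> (int \<Rightarrow> int) \<Rightarrow> (nat \<Rightarrow> real) set" where
  "proj a \<theta> x =
     (if x \<in> O_plus a then proj_plus a \<theta> x
      else \<ominus>\<^bsub>O_hat a \<theta>\<^esub> proj_plus a \<theta> (\<lambda>i. - x i))"

end

theory Submission
  imports Defs "HOL-Library.Multiset"
begin

text \<open>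
  On \<open>Z_adjoin \<theta>\<close> the absolute value \<open>theta_abs\<close> is comparable to the ordinary absolute value of the
  conjugate, so convergence in the completion means convergence of the alternating sums
  \<open>\<Sum>i. b i * (-1/\<theta>) ^ i\<close>. Among series with the greedy digit condition, two different ones can have
  the same alternating sum only if both have the extremal tail \<open>a, 0, a, 0, \<dots>\<close> from some point on; in
  particular both are infinite. A positive \<open>\<alpha>\<close> has a finite expansion, so nothing else can have the
  same image.
\<close>

subsection \<open>Quadratic units of norm \<open>-1\<close>\<close>

text \<open>An infinite digit series diverges at \<theta>; at the conjugate -1/\<theta> it
  converges, so every limit is taken after \<open>gconj\<close>. Two obstacles shape the way there.
  \<open>theta_abs\<close> sees an element only through its greedy expansion, so comparing it with
  the conjugate requires an expansion for every positive element of
  \<open>Z_adjoin \<theta>\<close>. And classes live over \<open>ring_of_integers \<theta>\<close>,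
  possibly larger than \<open>Z_adjoin \<theta>\<close>: a null sequence lies only eventually in
  \<open>Z_adjoin \<theta>\<close>, so a change of representative needs that adding elements of
  \<open>Z_adjoin \<theta>\<close> preserves algebraic integrality. The extremal values come from
  \<theta>^2 - 1 = a \<theta>: evaluated at -1/\<theta>, the digits a, 0, a, 0, ... sum to \<theta>
  and 0, a, 0, a, ... to -1.\<close>

lemma rat_bounded_denominator_imp_int:
  fixes r :: real and D :: int
  assumes "r \<in> \<rat>" and "D > 0" and pow: "\<And>k. of_int D * r ^ k \<in> \<int>"
  shows "r \<in> \<int>"
proof -
  obtain u v where uv: "v > 0" "coprime u v" "r = of_int u / of_int v"
    using assms(1) by (auto elim: Rats_cases')
  \<comment> \<open>Powers of the reduced denominator \<open>v\<close> are coprime to those of the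
    numerator, so all of them divide \<open>D\<close>; a \<open>v\<close> of at least 2 would
    outgrow \<open>D\<close>.\<close>
  have dvd: "v ^ k dvd D" for k
  proof -
    obtain w where "of_int D * r ^ k = of_int w" using pow[of k] by (auto elim: Ints_cases)
    hence "(of_int (D * u ^ k) :: real) = of_int (w * v ^ k)"
      using uv(1) by (simp add: uv(3) field_simps)
    hence "D * u ^ k = w * v ^ k" by (simp only: of_int_eq_iff)
    hence "v ^ k dvd D * u ^ k" by simp
    moreover have "coprime (v ^ k) (u ^ k)" using uv(2) by (simp add: coprime_commute)
    ultimately show ?thesis by (simp add: coprime_dvd_mult_left_iff)
  qed
  have "v = 1"
  proof (rule ccontr)
    assume "v \<noteq> 1"
    hence "v \<ge> 2" using uv(1) by simp
    have "int n < 2 ^ n" for n by simp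
    hence "D < 2 ^ nat D" using \<open>D > 0\<close> by (metis int_nat_eq less_imp_le)
    also have "\<dots> \<le> v ^ nat D" using \<open>v \<ge> 2\<close> by (intro power_mono) auto
    also have "\<dots> \<le> D" using dvd \<open>D > 0\<close> by (intro zdvd_imp_le) auto
    finally show False by simp
  qed
  thus ?thesis using uv(3) by simp
qed

locale quadratic_unit =
  fixes a :: int and \<theta> :: real
  assumes a_ge_1: "a \<ge> 1" and \<theta>_gt_1: "\<theta> > 1" and \<theta>_square: "\<theta>\<^sup>2 = of_int a * \<theta> + 1"
begin

text \<open>The second root of t^2 = a t + 1. The trace form has integer coordinates; norm -1 makes
  it equal to -1/\<theta>, the form used in all estimates.\<close>

definition \<theta>' :: real where "\<theta>' = of_int a - \<theta>"

lemma \<theta>_mult_\<theta>': "\<theta> * \<theta>' = - 1"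
  using \<theta>_square by (simp add: \<theta>'_def algebra_simps power2_eq_square)

lemma \<theta>'_eq: "\<theta>' = - (1 / \<theta>)"
  using \<theta>_mult_\<theta>' \<theta>_gt_1 by (simp add: field_simps)

lemma a_eq: "of_int a = \<theta> - 1 / \<theta>"
  using \<theta>'_eq by (simp add: \<theta>'_def)

lemma \<theta>'_square: "\<theta>'\<^sup>2 = of_int a * \<theta>' + 1"
  using \<theta>_square by (simp add: \<theta>'_def algebra_simps power2_eq_square)

lemma \<theta>'_nonzero: "\<theta>' \<noteq> 0"
  using \<theta>_gt_1 by (simp add: \<theta>'_eq)

lemma algebraic_int_\<theta>: "algebraic_int \<theta>"
proof (rule algebraic_int.intros)
  show "poly [:-1, - of_int a, 1:] \<theta> = 0"
    using \<theta>_square by (simp add: algebra_simps power2_eq_square)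
  show "\<forall>i. coeff [:-1, - of_int a, 1:] i \<in> (\<int> :: real set)"
    by (auto simp: coeff_pCons split: nat.splits)
qed auto

text \<open>A rational algebraic integer is an integer, and the equation then makes \<theta> a
  divisor of 1, against \<theta> > 1.\<close>

lemma \<theta>_irrational: "\<theta> \<notin> \<rat>"
proof
  assume "\<theta> \<in> \<rat>"
  then obtain t where t: "\<theta> = of_int t"
    using algebraic_int_\<theta> rational_algebraic_int_is_int by (auto elim: Ints_cases)
  have "(of_int (t * (t - a)) :: real) = of_int 1"
    using \<theta>_square unfolding t by (simp add: algebra_simps power2_eq_square)
  hence "t * (t - a) = 1" by (simp only: of_int_eq_iff)
  hence "t = 1 \<or> t = -1" by (simp add: zmult_eq_1_iff) linarith
  thus False using \<theta>_gt_1 t by auto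
qed

lemma coordinates_unique:
  assumes "p + q * \<theta> = p' + q' * \<theta>" and "p \<in> \<rat>" "q \<in> \<rat>" "p' \<in> \<rat>" "q' \<in> \<rat>"
  shows "p = p'" and "q = q'"
proof -
  show "q = q'"
  proof (rule ccontr)
    assume "q \<noteq> q'"
    hence "\<theta> = (p' - p) / (q - q')" using assms(1) by (simp add: field_simps)
    thus False using \<theta>_irrational assms by simp
  qed
  thus "p = p'" using assms(1) by simp
qed

subsection \<open>Conjugation\<close>

text \<open>The Galois conjugation \<theta> \<mapsto> \<theta>'. Irrationality makes the coordinates
  unique on \<open>quad_field \<theta>\<close>; elsewhere the value is unspecified, hence the
  membership premises below.\<close>

definition gconj :: "real \<Rightarrow> real" where
  "gconj x = (THE y. \<exists>p q. p \<in> \<rat> \<and> q \<in> \<rat> \<and> x = p + q * \<theta> \<and> y = p + q * \<theta>')"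

lemma gconj_eq:
  assumes "p \<in> \<rat>" "q \<in> \<rat>"
  shows "gconj (p + q * \<theta>) = p + q * \<theta>'"
  unfolding gconj_def using assms coordinates_unique by (intro the_equality) blast+

lemma quad_field_cases:
  assumes "x \<in> quad_field \<theta>"
  obtains p q where "p \<in> \<rat>" "q \<in> \<rat>" "x = p + q * \<theta>" "gconj x = p + q * \<theta>'"
  using assms gconj_eq by (auto simp: quad_field_def)

lemma quad_fieldI: "p \<in> \<rat> \<Longrightarrow> q \<in> \<rat> \<Longrightarrow> x = p + q * \<theta> \<Longrightarrow> x \<in> quad_field \<theta>"
  by (auto simp: quad_field_def)

lemma Z_adjoinI: "p \<in> \<int> \<Longrightarrow> q \<in> \<int> \<Longrightarrow> x = p + q * \<theta> \<Longrightarrow> x \<in> Z_adjoin \<theta>"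
  by (auto simp: Z_adjoin_def)

lemma Z_adjoin_cases:
  assumes "x \<in> Z_adjoin \<theta>"
  obtains p q where "x = of_int p + of_int q * \<theta>" "gconj x = of_int p + of_int q * \<theta>'"
proof -
  obtain p q where "p \<in> \<int>" "q \<in> \<int>" "x = p + q * \<theta>" using assms by (auto simp: Z_adjoin_def)
  then obtain p q where "x = of_int p + of_int q * \<theta>" by (auto elim!: Ints_cases)
  thus ?thesis using gconj_eq[of "of_int p" "of_int q"] that by auto
qed

lemma Z_adjoin_subset_quad_field: "Z_adjoin \<theta> \<subseteq> quad_field \<theta>"
  by (auto simp: Z_adjoin_def quad_field_def dest: Ints_subset_Rats[THEN subsetD])

lemmas Z_adjoin_quad_field = Z_adjoin_subset_quad_field[THEN subsetD]

lemma quad_field_add: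
  assumes "x \<in> quad_field \<theta>" "y \<in> quad_field \<theta>"
  shows "x + y \<in> quad_field \<theta>" and gconj_add: "gconj (x + y) = gconj x + gconj y"
proof -
  from assms(1) obtain p q where 1: "p \<in> \<rat>" "q \<in> \<rat>" "x = p + q * \<theta>" "gconj x = p + q * \<theta>'"
    by (rule quad_field_cases)
  from assms(2) obtain r s where 2: "r \<in> \<rat>" "s \<in> \<rat>" "y = r + s * \<theta>" "gconj y = r + s * \<theta>'"
    by (rule quad_field_cases)
  have eq: "x + y = (p + r) + (q + s) * \<theta>" using 1 2 by (simp add: algebra_simps)
  show "x + y \<in> quad_field \<theta>" using 1 2 by (intro quad_fieldI[OF _ _ eq]) auto
  show "gconj (x + y) = gconj x + gconj y"
    unfolding eq using 1 2 by (subst gconj_eq) (auto simp: algebra_simps)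
qed

lemma quad_field_mult:
  assumes "x \<in> quad_field \<theta>" "y \<in> quad_field \<theta>"
  shows "x * y \<in> quad_field \<theta>" and gconj_mult: "gconj (x * y) = gconj x * gconj y"
proof -
  from assms(1) obtain p q where 1: "p \<in> \<rat>" "q \<in> \<rat>" "x = p + q * \<theta>" "gconj x = p + q * \<theta>'"
    by (rule quad_field_cases)
  from assms(2) obtain r s where 2: "r \<in> \<rat>" "s \<in> \<rat>" "y = r + s * \<theta>" "gconj y = r + s * \<theta>'"
    by (rule quad_field_cases)
  \<comment> \<open>Stated for any root \<open>t\<close> of the equation, so that the same product
    coordinates serve \<theta> and its conjugate.\<close>
  have expand: "(p + q * t) * (r + s * t) = (p * r + q * s) + (p * s + q * r + of_int a * q * s) * t"
    if "t\<^sup>2 = of_int a * t + 1" for t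
  proof -
    have "(p + q * t) * (r + s * t) = p * r + (p * s + q * r) * t + q * s * t\<^sup>2"
      by (simp add: algebra_simps power2_eq_square)
    thus ?thesis unfolding that by (simp add: algebra_simps)
  qed
  have eq: "x * y = (p * r + q * s) + (p * s + q * r + of_int a * q * s) * \<theta>"
    using 1 2 expand[OF \<theta>_square] by simp
  show "x * y \<in> quad_field \<theta>" using 1 2 by (intro quad_fieldI[OF _ _ eq]) auto
  show "gconj (x * y) = gconj x * gconj y"
    unfolding eq using 1 2 expand[OF \<theta>'_square] by (subst gconj_eq) auto
qed

lemma quad_field_Rats: "x \<in> \<rat> \<Longrightarrow> x \<in> quad_field \<theta>" and gconj_Rats: "x \<in> \<rat> \<Longrightarrow> gconj x = x"
  using quad_fieldI[of x 0] gconj_eq[of x 0] by auto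

lemma quad_field_uminus:
  assumes "x \<in> quad_field \<theta>"
  shows "- x \<in> quad_field \<theta>" and gconj_uminus: "gconj (- x) = - gconj x"
  using quad_field_mult[OF _ assms, of "-1"] gconj_mult[OF _ assms, of "-1"]
  by (simp_all add: quad_field_Rats gconj_Rats)

lemma gconj_diff:
  assumes "x \<in> quad_field \<theta>" "y \<in> quad_field \<theta>"
  shows "gconj (x - y) = gconj x - gconj y"
  using gconj_add[OF assms(1) quad_field_uminus(1)[OF assms(2)]] gconj_uminus[OF assms(2)] by simp

lemma quad_field_power:
  assumes "x \<in> quad_field \<theta>"
  shows "x ^ k \<in> quad_field \<theta>" and gconj_power: "gconj (x ^ k) = gconj x ^ k"
  using assms by (induction k) (simp_all add: quad_field_Rats gconj_Rats quad_field_mult gconj_mult)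

section \<open>The ring \<open>Z_adjoin \<theta>\<close> and its stability under conjugation\<close>

lemma Z_adjoin_Ints: "x \<in> \<int> \<Longrightarrow> x \<in> Z_adjoin \<theta>"
  using Z_adjoinI[of x 0] by simp

lemma Z_adjoin_\<theta>: "\<theta> \<in> Z_adjoin \<theta>"
  using Z_adjoinI[of 0 1] by simp

lemma Z_adjoin_\<theta>': "\<theta>' \<in> Z_adjoin \<theta>"
  using Z_adjoinI[of "of_int a" "-1"] by (simp add: \<theta>'_def)

lemma gconj_\<theta>: "gconj \<theta> = \<theta>'"
  using gconj_eq[of 0 1] by simp

lemma gconj_\<theta>': "gconj \<theta>' = \<theta>"
  using gconj_eq[of "of_int a" "-1"] by (simp add: \<theta>'_def)

lemma Z_adjoin_add: "x \<in> Z_adjoin \<theta> \<Longrightarrow> y \<in> Z_adjoin \<theta> \<Longrightarrow> x + y \<in> Z_adjoin \<theta>"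
proof -
  assume "x \<in> Z_adjoin \<theta>" "y \<in> Z_adjoin \<theta>"
  then obtain p q r s where "x = of_int p + of_int q * \<theta>" "y = of_int r + of_int s * \<theta>"
    using Z_adjoin_cases by metis
  thus ?thesis
    by (intro Z_adjoinI[of "of_int (p + r)" "of_int (q + s)"]) (auto simp: algebra_simps)
qed

lemma Z_adjoin_mult: "x \<in> Z_adjoin \<theta> \<Longrightarrow> y \<in> Z_adjoin \<theta> \<Longrightarrow> x * y \<in> Z_adjoin \<theta>"
proof -
  assume "x \<in> Z_adjoin \<theta>" "y \<in> Z_adjoin \<theta>"
  then obtain p q r s where *: "x = of_int p + of_int q * \<theta>" "y = of_int r + of_int s * \<theta>"
    using Z_adjoin_cases by metis
  have "x * y = of_int (p * r) + of_int (p * s + q * r) * \<theta> + of_int (q * s) * \<theta>\<^sup>2"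
    using * by (simp add: algebra_simps power2_eq_square)
  thus ?thesis
    unfolding \<theta>_square
    by (intro Z_adjoinI[of "of_int (p * r + q * s)" "of_int (p * s + q * r + a * q * s)"])
      (auto simp: algebra_simps)
qed

lemma Z_adjoin_uminus: "x \<in> Z_adjoin \<theta> \<Longrightarrow> - x \<in> Z_adjoin \<theta>"
  using Z_adjoin_mult[OF Z_adjoin_Ints, of "-1" x] by simp

lemma Z_adjoin_diff: "x \<in> Z_adjoin \<theta> \<Longrightarrow> y \<in> Z_adjoin \<theta> \<Longrightarrow> x - y \<in> Z_adjoin \<theta>"
  using Z_adjoin_add[OF _ Z_adjoin_uminus] by fastforce

lemma Z_adjoin_power: "x \<in> Z_adjoin \<theta> \<Longrightarrow> x ^ k \<in> Z_adjoin \<theta>"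
  by (induction k) (auto intro: Z_adjoin_mult Z_adjoin_Ints)

lemma Z_adjoin_sum: "(\<And>i. i \<in> A \<Longrightarrow> f i \<in> Z_adjoin \<theta>) \<Longrightarrow> sum f A \<in> Z_adjoin \<theta>"
  by (induction A rule: infinite_finite_induct) (auto intro: Z_adjoin_add Z_adjoin_Ints)

lemma Z_adjoin_gconj: "x \<in> Z_adjoin \<theta> \<Longrightarrow> gconj x \<in> Z_adjoin \<theta>"
  by (erule Z_adjoin_cases) (simp add: Z_adjoin_add Z_adjoin_mult Z_adjoin_\<theta>' Z_adjoin_Ints)

lemma Z_adjoin_Rats_imp_Ints:
  assumes "x \<in> Z_adjoin \<theta>" "x \<in> \<rat>"
  shows "x \<in> \<int>"
proof -
  obtain p q where pq: "x = of_int p + of_int q * \<theta>"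
    using assms(1) by (rule Z_adjoin_cases)
  hence "x = of_int p" using coordinates_unique(1)[of x 0 "of_int p" "of_int q"] assms(2) by simp
  thus ?thesis by simp
qed

subsection \<open>Algebraic integers of the field\<close>

text \<open>Bounded denominators of the powers of an element characterise integrality, and this
  condition is visibly stable under translation by \<open>Z_adjoin \<theta>\<close>.\<close>

definition almost_integral :: "real \<Rightarrow> bool" where
  "almost_integral x \<longleftrightarrow> (\<exists>D :: int. D > 0 \<and> (\<forall>k. of_int D * x ^ k \<in> Z_adjoin \<theta>))"

lemma quad_field_denominator:
  assumes "x \<in> quad_field \<theta>"
  obtains d :: int where "d > 0" "of_int d * x \<in> Z_adjoin \<theta>"
proof -
  from assms obtain p q where pq: "p \<in> \<rat>" "q \<in> \<rat>" "x = p + q * \<theta>" by (rule quad_field_cases)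
  obtain s t where st: "t > 0" "p = of_int s / of_int t"
    using pq(1) by (elim Rats_cases') auto
  obtain u v where uv: "v > 0" "q = of_int u / of_int v"
    using pq(2) by (elim Rats_cases') auto
  have "of_int (t * v) * x = of_int (s * v) + of_int (t * u) * \<theta>"
    using st uv pq(3) by (simp add: field_simps)
  moreover have "t * v > 0" using st uv by simp
  ultimately show ?thesis using that Z_adjoinI by (metis Ints_of_int)
qed

text \<open>If \<open>d\<close> clears the denominator of \<open>x\<close> and \<open>n\<close> is
  the degree of a monic equation, then \<open>d ^ n\<close> serves for all powers: below
  \<open>n\<close> directly, from \<open>n\<close> on because the equation reduces a power to
  smaller ones with integer coefficients.\<close>

lemma algebraic_int_imp_almost_integral:
  assumes "algebraic_int x" "x \<in> quad_field \<theta>"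
  shows "almost_integral x"
proof -
  obtain P where P: "lead_coeff P = 1" "\<And>i. coeff P i \<in> \<int>" "poly P x = 0"
    using assms(1) by (auto elim: algebraic_int.cases)
  obtain d where d: "d > 0" "of_int d * x \<in> Z_adjoin \<theta>"
    using assms(2) by (rule quad_field_denominator)
  define n where "n = degree P"
  have x_n: "x ^ n = - (\<Sum>i<n. coeff P i * x ^ i)"
    using P(3) P(1) by (simp add: poly_altdef n_def lessThan_Suc_atMost[symmetric])
  have "of_int (d ^ n) * x ^ k \<in> Z_adjoin \<theta>" for k
  proof (induction k rule: less_induct)
    case (less k)
    show ?case
    proof (cases "k < n")
      case True
      have "of_int (d ^ n) * x ^ k = of_int (d ^ (n - k)) * (of_int d * x) ^ k"
        using True by (simp add: power_mult_distrib flip: power_add mult.assoc)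
      thus ?thesis using d(2) by (simp add: Z_adjoin_mult Z_adjoin_power Z_adjoin_Ints)
    next
      case False
      have "of_int (d ^ n) * x ^ k = of_int (d ^ n) * x ^ (k - n) * x ^ n"
        using False by (simp flip: power_add)
      also have "\<dots> = - (\<Sum>i<n. coeff P i * (of_int (d ^ n) * x ^ (k - n + i)))"
        unfolding x_n by (simp add: sum_distrib_left power_add mult_ac)
      also have "\<dots> \<in> Z_adjoin \<theta>"
        using False P(2)
        by (intro Z_adjoin_uminus Z_adjoin_sum Z_adjoin_mult[OF Z_adjoin_Ints less]) auto
      finally show ?thesis .
    qed
  qed
  thus ?thesis unfolding almost_integral_def using d(1) by (intro exI[of _ "d ^ n"]) auto
qed

lemma almost_integral_add:
  assumes "almost_integral x" "z \<in> Z_adjoin \<theta>"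
  shows "almost_integral (x + z)"
proof -
  obtain D where D: "D > 0" "\<And>k. of_int D * x ^ k \<in> Z_adjoin \<theta>"
    using assms(1) by (auto simp: almost_integral_def)
  have "of_int D * (x + z) ^ k \<in> Z_adjoin \<theta>" for k
  proof -
    have "of_int D * (x + z) ^ k = (\<Sum>i\<le>k. of_nat (k choose i) * (of_int D * x ^ i) * z ^ (k - i))"
      by (simp add: binomial_ring sum_distrib_left mult_ac)
    also have "\<dots> \<in> Z_adjoin \<theta>"
      by (intro Z_adjoin_sum Z_adjoin_mult[OF Z_adjoin_mult[OF Z_adjoin_Ints D(2)]]
          Z_adjoin_power[OF assms(2)]) auto
    finally show ?thesis .
  qed
  thus ?thesis using D(1) by (auto simp: almost_integral_def)
qed

lemma algebraic_int_quadratic: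
  fixes x t n :: real
  assumes "t \<in> \<int>" "n \<in> \<int>" "x\<^sup>2 - t * x + n = 0"
  shows "algebraic_int x"
proof (rule algebraic_int.intros)
  show "poly [:n, - t, 1:] x = 0"
    using assms(3) by (simp add: algebra_simps power2_eq_square)
  show "\<forall>i. coeff [:n, - t, 1:] i \<in> (\<int> :: real set)"
    using assms by (auto simp: coeff_pCons split: nat.splits)
qed auto

lemma quad_field_trace_norm:
  assumes "x \<in> quad_field \<theta>"
  shows "x + gconj x \<in> \<rat>" "x * gconj x \<in> \<rat>"
proof -
  from assms obtain p q where pq: "p \<in> \<rat>" "q \<in> \<rat>" "x = p + q * \<theta>" "gconj x = p + q * \<theta>'"
    by (rule quad_field_cases)
  have "x + gconj x = 2 * p + q * of_int a" using pq by (simp add: \<theta>'_def algebra_simps)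
  thus "x + gconj x \<in> \<rat>" using pq by simp
  have "x * gconj x = p * p + p * q * (\<theta> + \<theta>') + q * q * (\<theta> * \<theta>')"
    unfolding pq(4) unfolding pq(3) by (simp add: algebra_simps)
  also have "\<dots> = p * p + p * q * of_int a - q * q"
    unfolding \<theta>_mult_\<theta>' by (simp add: \<theta>'_def)
  finally show "x * gconj x \<in> \<rat>" using pq by simp
qed

text \<open>Trace and norm are rational with bounded denominators of all powers, hence integers, and
  \<open>x\<close> is a root of the resulting quadratic. The denominator is \<open>D * D\<close>
  because each term mixes a power of \<open>x\<close> with one of its conjugate.\<close>

lemma almost_integral_imp_algebraic_int:
  assumes "almost_integral x" and x: "x \<in> quad_field \<theta>"
  shows "algebraic_int x"
proof -
  obtain D where D: "D > 0" "\<And>k. of_int D * x ^ k \<in> Z_adjoin \<theta>"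
    using assms(1) by (auto simp: almost_integral_def)
  have D': "of_int D * gconj x ^ k \<in> Z_adjoin \<theta>" for k
    using Z_adjoin_gconj[OF D(2)[of k]] x
    by (simp add: gconj_mult quad_field_power gconj_power quad_field_Rats gconj_Rats)
  have trace_pow: "of_int (D * D) * (x + gconj x) ^ k \<in> \<int>" for k
  proof (rule Z_adjoin_Rats_imp_Ints)
    have "of_int (D * D) * (x + gconj x) ^ k =
        (\<Sum>i\<le>k. of_nat (k choose i) * (of_int D * x ^ i) * (of_int D * gconj x ^ (k - i)))"
      by (simp add: binomial_ring sum_distrib_left mult_ac)
    also have "\<dots> \<in> Z_adjoin \<theta>"
      by (intro Z_adjoin_sum Z_adjoin_mult[OF Z_adjoin_mult[OF Z_adjoin_Ints D(2)] D']) auto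
    finally show "of_int (D * D) * (x + gconj x) ^ k \<in> Z_adjoin \<theta>" .
    show "of_int (D * D) * (x + gconj x) ^ k \<in> \<rat>"
      using quad_field_trace_norm[OF x] by simp
  qed
  have trace: "x + gconj x \<in> \<int>"
    using D(1) by (intro rat_bounded_denominator_imp_int[OF quad_field_trace_norm(1)[OF x] _ trace_pow]) simp
  have norm_pow: "of_int (D * D) * (x * gconj x) ^ k \<in> \<int>" for k
  proof (rule Z_adjoin_Rats_imp_Ints)
    have "of_int (D * D) * (x * gconj x) ^ k = (of_int D * x ^ k) * (of_int D * gconj x ^ k)"
      by (simp add: power_mult_distrib)
    also have "\<dots> \<in> Z_adjoin \<theta>" by (intro Z_adjoin_mult D D')
    finally show "of_int (D * D) * (x * gconj x) ^ k \<in> Z_adjoin \<theta>" .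
    show "of_int (D * D) * (x * gconj x) ^ k \<in> \<rat>"
      using quad_field_trace_norm[OF x] by simp
  qed
  have norm: "x * gconj x \<in> \<int>"
    using D(1) by (intro rat_bounded_denominator_imp_int[OF quad_field_trace_norm(2)[OF x] _ norm_pow]) simp
  show ?thesis
    using algebraic_int_quadratic[OF trace norm] by (simp add: algebra_simps power2_eq_square)
qed

text \<open>Needed for the finitely many terms of a null sequence that may lie outside
  \<open>Z_adjoin \<theta>\<close>.\<close>

lemma ring_of_integers_add_Z_adjoin:
  assumes "x \<in> ring_of_integers \<theta>" "z \<in> Z_adjoin \<theta>"
  shows "x + z \<in> ring_of_integers \<theta>"
  using assms algebraic_int_imp_almost_integral almost_integral_add
    almost_integral_imp_algebraic_int quad_field_add(1) Z_adjoin_quad_field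
  by (simp add: ring_of_integers_def)

lemma Z_adjoin_ring_of_integers: "z \<in> Z_adjoin \<theta> \<Longrightarrow> z \<in> ring_of_integers \<theta>"
  using ring_of_integers_add_Z_adjoin[of 0 z]
  by (simp add: ring_of_integers_def quad_field_Rats)

end

subsection \<open>Evaluation of digit functions\<close>

lemma eval_poly_superset:
  assumes "finite A" "supp b \<subseteq> A"
  shows "eval_poly t b = (\<Sum>i\<in>A. of_int (b i) * t powi i)"
  unfolding eval_poly_def using assms by (intro sum.mono_neutral_left) (auto simp: supp_def)

lemma eval_poly_add:
  assumes "finite (supp b)" "finite (supp c)"
  shows "eval_poly t (\<lambda>i. b i + c i) = eval_poly t b + eval_poly t c"
proof -
  have "supp (\<lambda>i. b i + c i) \<subseteq> supp b \<union> supp c" by (auto simp: supp_def)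
  thus ?thesis
    using assms eval_poly_superset[of "supp b \<union> supp c"]
    by (simp add: sum.distrib algebra_simps)
qed

text \<open>Exponents range over all integers, so a least disagreement exists only thanks to the
  agreement below \<open>m\<close>; shifting by \<open>m\<close> reduces it to \<open>LEAST\<close>
  on naturals.\<close>

lemma first_difference:
  fixes x y :: "int \<Rightarrow> 'a"
  assumes "x \<noteq> y" "\<And>i. i < m \<Longrightarrow> x i = y i"
  obtains j where "x j \<noteq> y j" "\<And>i. i < j \<Longrightarrow> x i = y i"
proof -
  define P where "P k \<longleftrightarrow> x (m + int k) \<noteq> y (m + int k)" for k
  obtain i where i: "x i \<noteq> y i" using assms(1) by auto
  hence "i \<ge> m" using assms(2) by force
  hence "P (nat (i - m))" using i by (simp add: P_def)
  define k where "k = (LEAST k. P k)"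
  have "P k" unfolding k_def using \<open>P (nat (i - m))\<close> by (rule LeastI)
  hence "x (m + int k) \<noteq> y (m + int k)" by (simp add: P_def)
  moreover have "x i = y i" if "i < m + int k" for i
  proof (cases "i < m")
    case False
    hence "nat (i - m) < k" using that by linarith
    hence "\<not> P (nat (i - m))" unfolding k_def by (rule not_less_Least)
    thus ?thesis using False by (simp add: P_def)
  qed (use assms(2) in auto)
  ultimately show ?thesis by (rule that)
qed

lemma greedy_polyD:
  assumes "greedy_poly a b"
  shows "finite (supp b)" "0 \<le> b i" "b i \<le> a" "b i = a \<Longrightarrow> b (i - 1) = 0"
  using assms by (auto simp: greedy_poly_def)

lemma supp_bounded_above:
  assumes "finite (supp b)"
  obtains K where "\<And>i. i \<ge> K \<Longrightarrow> b i = 0"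
proof -
  \<comment> \<open>Inserting 0 covers the empty support, where \<open>Max\<close> is
    unspecified.\<close>
  have "b i = 0" if "i \<ge> Max (insert 0 (supp b)) + 1" for i
  proof (rule ccontr)
    assume "b i \<noteq> 0"
    hence "i \<le> Max (insert 0 (supp b))" using assms by (intro Max_ge) (auto simp: supp_def)
    thus False using that by simp
  qed
  thus ?thesis using that by blast
qed

lemma supp_bounded_below:
  assumes "finite (supp b)"
  obtains m where "\<And>i. i < m \<Longrightarrow> b i = 0"
proof -
  have "b i = 0" if "i < Min (insert 0 (supp b))" for i
  proof (rule ccontr)
    assume "b i \<noteq> 0"
    hence "Min (insert 0 (supp b)) \<le> i" using assms by (intro Min_le) (auto simp: supp_def)
    thus False using that by simp
  qed
  thus ?thesis using that by blast
qed

lemma greedy_poly_truncate: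
  assumes "greedy_poly a b"
  shows "greedy_poly a (truncate n b)"
proof -
  have "supp (truncate n b) \<subseteq> supp b" by (auto simp: supp_def truncate_def)
  thus ?thesis using assms finite_subset by (auto simp: greedy_poly_def truncate_def)
qed

lemma truncate_eq_self:
  assumes "greedy_poly a b"
  obtains N where "\<And>n. n \<ge> N \<Longrightarrow> truncate n b = b"
proof -
  obtain K where "\<And>i. i \<ge> K \<Longrightarrow> b i = 0"
    using supp_bounded_above greedy_polyD(1)[OF assms] by blast
  hence "truncate n b = b" if "n \<ge> K" for n using that by (auto simp: truncate_def)
  thus ?thesis using that by blast
qed

lemma greedy_poly_O_plus: "greedy_poly a b \<Longrightarrow> b \<in> O_plus a"
  using supp_bounded_below greedy_polyD(1) greedy_poly_truncate unfolding O_plus_def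
  by (smt (verit) mem_Collect_eq)

section \<open>Estimates for conjugates of greedy polynomials\<close>

context quadratic_unit
begin

text \<open>\<theta> is a unit: its negative powers stay in \<open>Z_adjoin \<theta>\<close>, so
  Laurent polynomials cause no denominators.\<close>

lemma inverse_\<theta>: "inverse \<theta> = - \<theta>'" and inverse_\<theta>': "inverse \<theta>' = - \<theta>"
  using \<theta>_gt_1 by (simp_all add: \<theta>'_eq field_simps)

lemma powi_\<theta>:
  "\<theta> powi i \<in> Z_adjoin \<theta>" "gconj (\<theta> powi i) = \<theta>' powi i"
  by (simp_all add: power_int_def inverse_\<theta> inverse_\<theta>' Z_adjoin_power Z_adjoin_\<theta> Z_adjoin_\<theta>'
      Z_adjoin_uminus gconj_power gconj_uminus gconj_\<theta> gconj_\<theta>' Z_adjoin_quad_field)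

lemma eval_poly_Z_adjoin: "eval_poly \<theta> b \<in> Z_adjoin \<theta>"
  unfolding eval_poly_def
  by (intro Z_adjoin_sum Z_adjoin_mult[OF Z_adjoin_Ints powi_\<theta>(1)]) simp

lemma gconj_sum:
  "(\<And>i. i \<in> A \<Longrightarrow> f i \<in> Z_adjoin \<theta>) \<Longrightarrow> gconj (sum f A) = (\<Sum>i\<in>A. gconj (f i))"
  by (induction A rule: infinite_finite_induct)
    (simp_all add: gconj_Rats gconj_add Z_adjoin_sum Z_adjoin_quad_field)

lemma gconj_eval_poly: "gconj (eval_poly \<theta> b) = eval_poly \<theta>' b"
  unfolding eval_poly_def
  by (subst gconj_sum)
    (simp_all add: Z_adjoin_mult Z_adjoin_Ints powi_\<theta> gconj_mult gconj_Rats quad_field_Rats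
      Z_adjoin_quad_field)

lemma abs_powi_\<theta>': "\<bar>\<theta>' powi i\<bar> = \<theta> powi (- i)"
  using \<theta>_gt_1 by (simp add: power_int_abs \<theta>'_eq power_int_minus flip: power_int_inverse)
    (simp add: field_simps)

text \<open>The conjugate of a greedy polynomial is a polynomial in \<open>\<theta>' = -1/\<theta>\<close>, hence alternating.
  The recursion \<open>tail j b = b j - tail (j + 1) b / \<theta>\<close> turns the upper bound for one tail into
  the lower bound for the next one, and conversely; the digit condition enters through
  \<open>b j \<ge> 1 \<Longrightarrow> b (j + 1) \<le> a - 1\<close>.\<close>

definition tail :: "int \<Rightarrow> (int \<Rightarrow> int) \<Rightarrow> real" where
  "tail j b = (\<Sum>i\<in>{i \<in> supp b. j \<le> i}. of_int (b i) * \<theta>' powi (i - j))"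

lemma tail_rec:
  assumes "finite (supp b)"
  shows "tail j b = of_int (b j) - tail (j + 1) b / \<theta>"
proof -
  have fin: "finite {i \<in> supp b. j + 1 \<le> i}" using assms by simp
  have "tail j b = (\<Sum>i\<in>insert j {i \<in> supp b. j + 1 \<le> i}. of_int (b i) * \<theta>' powi (i - j))"
    unfolding tail_def using assms by (intro sum.mono_neutral_left) (auto simp: supp_def)
  also have "\<dots> = of_int (b j) + (\<Sum>i\<in>{i \<in> supp b. j + 1 \<le> i}. of_int (b i) * \<theta>' powi (i - j))"
    using fin by simp
  also have "(\<Sum>i\<in>{i \<in> supp b. j + 1 \<le> i}. of_int (b i) * \<theta>' powi (i - j)) = \<theta>' * tail (j + 1) b"
    unfolding tail_def sum_distrib_left
  proof (rule sum.cong)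
    fix i
    have "\<theta>' powi (i - j) = \<theta>' powi (1 + (i - (j + 1)))" by simp
    also have "\<dots> = \<theta>' * \<theta>' powi (i - (j + 1))"
      using \<theta>'_nonzero by (subst power_int_add) auto
    finally show "of_int (b i) * \<theta>' powi (i - j) = \<theta>' * (of_int (b i) * \<theta>' powi (i - (j + 1)))"
      by simp
  qed simp
  finally show ?thesis by (simp add: \<theta>'_eq)
qed

text \<open>The bounds are the values of infinite tails ending in a, 0, a, 0, ..., which a finite
  tail cannot reach. The sharper lower bound for a nonzero digit \<open>c + 1\<close> is
  \<open>c + 1 / \<theta>\<close>, exactly the upper bound for the digit \<open>c\<close>: different
  digits give disjoint open intervals.\<close>

lemma tail_bounds:
  assumes "greedy_poly a b"
  shows "of_int (b j) - 1 < tail j b \<and> tail j b < of_int (b j) + 1 / \<theta> \<and>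
    (b j \<noteq> 0 \<longrightarrow> of_int (b j) - 1 + 1 / \<theta> < tail j b)" (is "?P j")
proof -
  obtain K where K: "\<And>i. i \<ge> K \<Longrightarrow> b i = 0"
    using supp_bounded_above greedy_polyD(1)[OF assms] by blast
  have zero: "?P j" if "j \<ge> K" for j
  proof -
    have empty: "{i \<in> supp b. j \<le> i} = {}" using K that by (auto simp: supp_def)
    have "tail j b = 0" unfolding tail_def empty by simp
    moreover have "0 < 1 / \<theta>" using \<theta>_gt_1 by simp
    ultimately show ?thesis using K[OF that] by auto
  qed
  show ?thesis
  proof (cases "j \<le> K")
    case True
    thus ?thesis
    \<comment> \<open>Downward induction from an index beyond the support, where the tail is
      0.\<close>
    proof (induction j rule: int_le_induct)
      case base
      show ?case using zero[of K] by simp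
    next
      case (step j)
      define T where "T = tail j b"
      have rec: "tail (j - 1) b = of_int (b (j - 1)) - T / \<theta>"
        using tail_rec[OF greedy_polyD(1)[OF assms], of "j - 1"] by (simp add: T_def)
      have "of_int (b j) - 1 < T" "T < of_int (b j) + 1 / \<theta>" using step by (auto simp: T_def)
      moreover have "(0::real) \<le> of_int (b j)" using greedy_polyD(2)[OF assms] by simp
      ultimately have "- 1 < T" by linarith
      hence upper: "- (T / \<theta>) < 1 / \<theta>" using \<theta>_gt_1 by (simp add: field_simps)
      have "(of_int (b j) :: real) \<le> of_int a" using greedy_polyD(3)[OF assms] by simp
      hence "T < \<theta>" using \<open>T < _\<close> a_eq by linarith
      hence lower: "T / \<theta> < 1" using \<theta>_gt_1 by simp
      have "T / \<theta> < 1 - 1 / \<theta>" if "b (j - 1) \<noteq> 0"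
      proof -
        have "b j \<le> a - 1" using greedy_polyD(3,4)[OF assms, of j] that by linarith
        hence "(of_int (b j) :: real) \<le> of_int (a - 1)" by (simp only: of_int_le_iff)
        hence "T < \<theta> - 1" using \<open>T < of_int _ + _\<close> a_eq by simp
        thus ?thesis using \<theta>_gt_1 by (simp add: field_simps)
      qed
      thus ?case using upper lower rec by auto
    qed
  qed (use zero in auto)
qed

lemma eval_poly_tail:
  assumes "finite (supp b)"
  shows "eval_poly \<theta>' b =
    (\<Sum>i\<in>{i \<in> supp b. i < j}. of_int (b i) * \<theta>' powi i) + \<theta>' powi j * tail j b"
proof -
  have "supp b = {i \<in> supp b. i < j} \<union> {i \<in> supp b. j \<le> i}" by auto
  hence "eval_poly \<theta>' b = (\<Sum>i\<in>{i \<in> supp b. i < j} \<union> {i \<in> supp b. j \<le> i}. of_int (b i) * \<theta>' powi i)"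
    by (simp add: eval_poly_def)
  also have "\<dots> = (\<Sum>i\<in>{i \<in> supp b. i < j}. of_int (b i) * \<theta>' powi i)
      + (\<Sum>i\<in>{i \<in> supp b. j \<le> i}. of_int (b i) * \<theta>' powi i)"
    using assms by (intro sum.union_disjoint) auto
  also have "(\<Sum>i\<in>{i \<in> supp b. j \<le> i}. of_int (b i) * \<theta>' powi i) = \<theta>' powi j * tail j b"
    unfolding tail_def sum_distrib_left
  proof (rule sum.cong)
    fix i
    have "\<theta>' powi i = \<theta>' powi (j + (i - j))" by simp
    also have "\<dots> = \<theta>' powi j * \<theta>' powi (i - j)"
      using \<theta>'_nonzero by (subst power_int_add) auto
    finally show "of_int (b i) * \<theta>' powi i = \<theta>' powi j * (of_int (b i) * \<theta>' powi (i - j))"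
      by simp
  qed simp
  finally show ?thesis .
qed

lemma eval_poly_tail_vanish:
  assumes "finite (supp b)" "\<And>i. i < j \<Longrightarrow> b i = 0"
  shows "eval_poly \<theta>' b = \<theta>' powi j * tail j b"
proof -
  have empty: "{i \<in> supp b. i < j} = {}" using assms(2) by (auto simp: supp_def)
  show ?thesis unfolding eval_poly_tail[OF assms(1), of j] empty by simp
qed

text \<open>The tail lies between -1 and a + 1/\<theta> = \<theta>. Used with
  \<open>j = K + 1\<close>, it bounds whatever lives beyond index \<open>K\<close> by
  \<open>\<theta> powi (- K)\<close>.\<close>

lemma abs_conj_eval_less:
  assumes "greedy_poly a b" "\<And>i. i < j \<Longrightarrow> b i = 0"
  shows "\<bar>eval_poly \<theta>' b\<bar> < \<theta> powi (1 - j)"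
proof -
  have "(0::real) \<le> of_int (b j)" "(of_int (b j) :: real) \<le> of_int a"
    using greedy_polyD(2,3)[OF assms(1)] by auto
  hence "\<bar>tail j b\<bar> < \<theta>"
    using tail_bounds[OF assms(1), of j] a_eq \<theta>_gt_1 by linarith
  hence "\<bar>eval_poly \<theta>' b\<bar> < \<theta> powi (- j) * \<theta>"
    using eval_poly_tail_vanish[OF greedy_polyD(1)[OF assms(1)] assms(2)] \<theta>_gt_1
    by (simp add: abs_mult abs_powi_\<theta>')
  also have "\<dots> = \<theta> powi (1 - j)" using \<theta>_gt_1 by (simp add: power_int_diff power_int_minus field_simps)
  finally show ?thesis .
qed

text \<open>A nonzero lowest digit is at least 1, and the sharper tail bound then leaves more than
  1/\<theta>: the alternating signs cannot cancel it.\<close>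

lemma abs_conj_eval_greater:
  assumes "greedy_poly a b" "\<And>i. i < j \<Longrightarrow> b i = 0" "b j \<noteq> 0"
  shows "\<theta> powi (- j - 1) < \<bar>eval_poly \<theta>' b\<bar>"
proof -
  have "1 \<le> b j" using greedy_polyD(2)[OF assms(1), of j] assms(3) by linarith
  hence "1 / \<theta> < tail j b" using tail_bounds[OF assms(1), of j] assms(3) by auto
  hence "1 / \<theta> < \<bar>tail j b\<bar>" by linarith
  hence "\<theta> powi (- j) * (1 / \<theta>) < \<bar>eval_poly \<theta>' b\<bar>"
    using eval_poly_tail_vanish[OF greedy_polyD(1)[OF assms(1)] assms(2)] \<theta>_gt_1
    by (simp only: abs_mult abs_powi_\<theta>') (intro mult_strict_left_mono, auto)
  moreover have "\<theta> powi (- j) * (1 / \<theta>) = \<theta> powi (- j - 1)"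
    using \<theta>_gt_1 by (simp add: power_int_diff)
  ultimately show ?thesis by simp
qed

text \<open>At the first difference both tails lie on the two sides of a number that only an infinite
  alternating tail can reach, so the finite expansion keeps a positive distance.\<close>

lemma conj_eval_gap:
  assumes b: "greedy_poly a b" and x: "x \<in> O_plus a" and "x \<noteq> b"
  obtains c N where "c > 0" "\<And>n. n \<ge> N \<Longrightarrow> c \<le> \<bar>eval_poly \<theta>' (truncate n x) - eval_poly \<theta>' b\<bar>"
proof -
  obtain m where m: "\<And>i. i < m \<Longrightarrow> x i = 0" using x by (auto simp: O_plus_def)
  obtain m' where m': "\<And>i. i < m' \<Longrightarrow> b i = 0"
    using supp_bounded_below greedy_polyD(1)[OF b] by blast
  obtain j where j: "x j \<noteq> b j" and below: "\<And>i. i < j \<Longrightarrow> x i = b i"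
    using first_difference[OF \<open>x \<noteq> b\<close>, of "min m m'"] m m' by auto
  have greedy: "greedy_poly a (truncate n x)" for n using x by (simp add: O_plus_def)
  define T where "T = tail j b"
  \<comment> \<open>Once \<open>n \<ge> j\<close>, the truncation keeps all digits below
    \<open>j\<close>, where \<open>x\<close> and \<open>b\<close> agree, so only the tails at
    \<open>j\<close> contribute.\<close>
  have diff: "\<bar>eval_poly \<theta>' (truncate n x) - eval_poly \<theta>' b\<bar> =
      \<theta> powi (- j) * \<bar>tail j (truncate n x) - T\<bar>" if "n \<ge> j" for n
  proof -
    have set_eq: "{i \<in> supp (truncate n x). i < j} = {i \<in> supp b. i < j}"
      using that below by (auto simp: supp_def truncate_def)
    have low: "(\<Sum>i\<in>{i \<in> supp (truncate n x). i < j}. of_int (truncate n x i) * \<theta>' powi i) =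
        (\<Sum>i\<in>{i \<in> supp b. i < j}. of_int (b i) * \<theta>' powi i)"
      unfolding set_eq using that below by (intro sum.cong) (auto simp: truncate_def)
    have "eval_poly \<theta>' (truncate n x) - eval_poly \<theta>' b = \<theta>' powi j * (tail j (truncate n x) - T)"
      unfolding eval_poly_tail[OF greedy_polyD(1)[OF greedy], of _ j]
        eval_poly_tail[OF greedy_polyD(1)[OF b], of j] low T_def by (simp add: algebra_simps)
    thus ?thesis by (simp add: abs_mult abs_powi_\<theta>')
  qed
  have "\<exists>e>0. \<forall>n\<ge>j. e \<le> \<bar>tail j (truncate n x) - T\<bar>"
  proof (cases "x j > b j")
    case True
    \<comment> \<open>The distance from \<open>T\<close> to the endpoint
      \<open>b j + 1 / \<theta>\<close>. The digit \<open>x j\<close> is nonzero and at least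
      \<open>b j + 1\<close>, so its tails stay beyond that endpoint for every
      \<open>n\<close>.\<close>
    define e where "e = of_int (b j) + 1 / \<theta> - T"
    have "e > 0" using tail_bounds[OF b, of j] by (simp add: e_def T_def)
    moreover have "e \<le> \<bar>tail j (truncate n x) - T\<bar>" if "n \<ge> j" for n
    proof -
      have "truncate n x j = x j" using that by (simp add: truncate_def)
      moreover have "x j \<noteq> 0" using True greedy_polyD(2)[OF b, of j] by linarith
      moreover have "(of_int (b j) :: real) \<le> of_int (x j) - 1" using True by linarith
      ultimately show ?thesis using tail_bounds[OF greedy, of n j] unfolding e_def by auto
    qed
    ultimately show ?thesis by blast
  next
    case False
    hence less: "x j < b j" using j by linarith
    have "x j \<ge> 0" using greedy_polyD(2)[OF greedy, of j j] by (simp add: truncate_def)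
    hence "b j \<noteq> 0" using less by linarith
    \<comment> \<open>The mirror case: now \<open>b j\<close> is the nonzero digit, and the
      separating endpoint is its sharper lower bound.\<close>
    define e where "e = T - (of_int (b j) - 1 + 1 / \<theta>)"
    have "e > 0" using tail_bounds[OF b, of j] \<open>b j \<noteq> 0\<close> by (simp add: e_def T_def)
    moreover have "e \<le> \<bar>tail j (truncate n x) - T\<bar>" if "n \<ge> j" for n
    proof -
      have "truncate n x j = x j" using that by (simp add: truncate_def)
      moreover have "(of_int (x j) :: real) \<le> of_int (b j) - 1" using less by linarith
      ultimately show ?thesis using tail_bounds[OF greedy, of n j] unfolding e_def by auto
    qed
    ultimately show ?thesis by blast
  qed
  then obtain e where "e > 0" "\<And>n. n \<ge> j \<Longrightarrow> e \<le> \<bar>tail j (truncate n x) - T\<bar>" by blast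
  thus ?thesis using that[of "\<theta> powi (- j) * e" j] diff \<theta>_gt_1 by simp
qed

text \<open>A finite polynomial equals its late truncations, so the gap would be a positive bound
  for 0. This gives uniqueness of greedy expansions.\<close>

lemma conj_eval_inj:
  assumes "greedy_poly a b" "greedy_poly a c" "eval_poly \<theta>' b = eval_poly \<theta>' c"
  shows "b = c"
proof (rule ccontr)
  assume "b \<noteq> c"
  then obtain e N where e: "e > 0"
    "\<And>n. n \<ge> N \<Longrightarrow> e \<le> \<bar>eval_poly \<theta>' (truncate n b) - eval_poly \<theta>' c\<bar>"
    using conj_eval_gap assms greedy_poly_O_plus by metis
  obtain N' where "\<And>n. n \<ge> N' \<Longrightarrow> truncate n b = b" using truncate_eq_self assms(1) by blast
  hence "truncate (max N N') b = b" by simp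
  thus False using e(1) e(2)[of "max N N'"] assms(3) by simp
qed

lemma greedy_expansion_eqI:
  assumes "greedy_expands a \<theta> b \<alpha>"
  shows "greedy_expansion a \<theta> \<alpha> = b"
  unfolding greedy_expansion_def
proof (rule the_equality)
  fix c assume "greedy_expands a \<theta> c \<alpha>"
  thus "c = b" using assms conj_eval_inj gconj_eval_poly unfolding greedy_expands_def by metis
qed (fact assms)

subsection \<open>Existence of greedy expansions\<close>

text \<open>Sums of powers of \<theta> are encoded as multisets of exponents, so that the number of
  summands is \<open>size\<close> and a carry is an exchange of elements.\<close>

definition digits :: "int multiset \<Rightarrow> int \<Rightarrow> int" where
  "digits C = (\<lambda>i. int (count C i))"

definition mset_value :: "int multiset \<Rightarrow> real" where
  "mset_value C = (\<Sum>i\<in>#C. \<theta> powi i)"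

lemma supp_digits: "supp (digits C) = set_mset C"
  by (auto simp: supp_def digits_def)

lemma mset_value_simps [simp]:
  "mset_value {#} = 0"
  "mset_value (add_mset i C) = \<theta> powi i + mset_value C"
  "mset_value (C + D) = mset_value C + mset_value D"
  "mset_value (replicate_mset n i) = of_nat n * \<theta> powi i"
  by (simp_all add: mset_value_def)

lemma eval_poly_digits: "eval_poly \<theta> (digits C) = mset_value C"
proof (induction C)
  case empty
  show ?case by (simp add: eval_poly_def supp_digits)
next
  case (add k C)
  define e :: "int \<Rightarrow> int" where "e i = (if i = k then 1 else 0)" for i
  have supp_e: "supp e = {k}" by (auto simp: supp_def e_def)
  have "digits (add_mset k C) = (\<lambda>i. e i + digits C i)"
    by (auto simp: digits_def e_def)
  thus ?case
    using add eval_poly_add[of e "digits C" \<theta>]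
    by (simp add: supp_e supp_digits) (simp add: eval_poly_def supp_e e_def)
qed

lemma mset_value_nonneg: "mset_value C \<ge> 0"
  using \<theta>_gt_1 by (induction C) auto

lemma powi_le_mset_value: "k \<in># C \<Longrightarrow> \<theta> powi k \<le> mset_value C"
  using mset_value_nonneg by (auto dest!: multi_member_split)

lemma powi_bounded_above:
  obtains K where "\<And>k. \<theta> powi k \<le> v \<Longrightarrow> k \<le> K"
proof -
  obtain n where n: "v < \<theta> ^ n" using real_arch_pow[OF \<theta>_gt_1] by blast
  have "k \<le> int n" if "\<theta> powi k \<le> v" for k
  proof (rule ccontr)
    assume "\<not> k \<le> int n"
    hence "\<theta> powi int n \<le> \<theta> powi k" using \<theta>_gt_1 by (intro power_int_increasing) auto
    thus False using that n by simp
  qed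
  thus ?thesis using that by blast
qed

lemma powi_add_1: "\<theta> powi (k + 1) = of_int a * \<theta> powi k + \<theta> powi (k - 1)"
proof -
  have "\<theta> powi (k - 1 + 2) = \<theta> powi (k - 1) * \<theta>\<^sup>2"
    using \<theta>_gt_1 by (subst power_int_add) auto
  moreover have "\<theta> powi (k - 1 + 1) = \<theta> powi (k - 1) * \<theta>"
    using \<theta>_gt_1 by (subst power_int_add) auto
  ultimately show ?thesis unfolding \<theta>_square by (simp add: algebra_simps)
qed

text \<open>Of \<open>a + 1\<close> equal powers, one splits one level down; one of the resulting
  \<open>\<theta> powi (k - 1)\<close> joins the other \<open>a\<close> powers to form
  \<open>\<theta> powi (k + 1)\<close>. Both sides have \<open>a + 1\<close> summands.\<close>

lemma powi_carry:
  "of_int (a + 1) * \<theta> powi k = \<theta> powi (k + 1) + of_int (a - 1) * \<theta> powi (k - 1) + \<theta> powi (k - 2)"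
  using powi_add_1[of k] powi_add_1[of "k - 1"] by (simp add: algebra_simps)

text \<open>Among all sums of at most \<open>N\<close> powers of \<open>\<theta>\<close> with the given value, take one whose largest
  exponent \<open>k\<close> is maximal, and expand the remaining powers by induction. If adding \<open>\<theta> powi k\<close> to that
  expansion violated the digit condition, a carry would produce the exponent \<open>k + 1\<close>
  without increasing the number of summands.\<close>

lemma greedy_mset_exists:
  "size M \<le> N \<Longrightarrow>
    \<exists>C. greedy_poly a (digits C) \<and> mset_value C = mset_value M \<and> size C \<le> N"
proof (induction N arbitrary: M)
  case 0
  hence "greedy_poly a (digits {#})"
    using a_ge_1 by (auto simp: greedy_poly_def supp_def digits_def)
  thus ?case using 0 by (intro exI[of _ "{#}"]) auto
next
  case (Suc N)
  show ?case
  proof (cases "M = {#}")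
    case True
    thus ?thesis using Suc.IH[of M] by auto
  next
    case False
    define R where "R = {C. size C \<le> Suc N \<and> mset_value C = mset_value M}"
    define E where "E = (\<Union>C\<in>R. set_mset C)"
    obtain K where K: "\<And>k. \<theta> powi k \<le> mset_value M \<Longrightarrow> k \<le> K"
      using powi_bounded_above by blast
    have E_le: "k \<le> K" if "k \<in> E" for k
      using that powi_le_mset_value K by (force simp: E_def R_def)
    obtain l where l: "l \<in># M" using False by blast
    hence "l \<in> E" using Suc.prems by (auto simp: E_def R_def)
    \<comment> \<open>\<open>E\<close> is bounded above but possibly infinite downwards; cutting at
      the exponent \<open>l\<close> makes the set finite without losing its maximum.\<close>
    define k where "k = Max {i \<in> E. l \<le> i}"
    have "{i \<in> E. l \<le> i} \<subseteq> {l..K}" using E_le by auto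
    hence fin: "finite {i \<in> E. l \<le> i}" by (rule finite_subset) simp
    hence "k \<in> {i \<in> E. l \<le> i}" unfolding k_def using \<open>l \<in> E\<close> by (intro Max_in) auto
    hence "k \<in> E" "l \<le> k" by auto
    have max: "i \<le> k" if "i \<in> E" for i
    proof (cases "l \<le> i")
      case True
      thus ?thesis unfolding k_def using fin that by (intro Max_ge) auto
    qed (use \<open>l \<le> k\<close> in auto)
    have max_R: "i \<le> k" if "D \<in> R" "i \<in># D" for i D
      using max[of i] that unfolding E_def by blast
    obtain M' where M': "add_mset k M' \<in> R"
      using \<open>k \<in> E\<close> by (auto simp: E_def dest!: multi_member_split)
    hence "size M' \<le> N" by (simp add: R_def)
    then obtain C where C: "greedy_poly a (digits C)" "mset_value C = mset_value M'" "size C \<le> N"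
      using Suc.IH by blast
    have kC: "add_mset k C \<in> R" using C M' by (simp add: R_def)
    have C_le: "i \<le> k" if "i \<in># C" for i using max_R[OF kC] that by simp
    have no_carry: False if "add_mset (k + 1) D \<in> R" for D
      using max_R[OF that, of "k + 1"] by simp
    have digit_k: "count C k \<le> nat a" using greedy_polyD(3)[OF C(1), of k] by (simp add: digits_def)
    define D where "D = filter_mset (\<lambda>i. i \<noteq> k) C"
    have split: "replicate_mset (count C k) k + D = C"
      by (simp add: D_def multiset_eq_iff)
    have val_C: "mset_value C = of_nat (count C k) * \<theta> powi k + mset_value D"
      using arg_cong[OF split, of mset_value] by simp
    have size_C: "size C = count C k + size D"
      using arg_cong[OF split, of size] by simp
    have "count C k \<noteq> nat a"
    proof
      assume eq: "count C k = nat a"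
      have "mset_value (add_mset (k + 1) (replicate_mset (nat (a - 1)) (k - 1) + add_mset (k - 2) D))
          = mset_value (add_mset k C)"
        using powi_carry[of k] a_ge_1 val_C eq by (simp add: algebra_simps)
      moreover have "size (add_mset (k + 1) (replicate_mset (nat (a - 1)) (k - 1) + add_mset (k - 2) D))
          = size (add_mset k C)"
        using size_C eq a_ge_1 by simp
      ultimately show False using no_carry kC unfolding R_def by (metis (mono_tags, lifting) mem_Collect_eq)
    qed
    \<comment> \<open>With the new \<open>k\<close> there would be \<open>a\<close> copies of it
      next to a \<open>k - 1\<close>, which merge into the forbidden exponent
      \<open>k + 1\<close>.\<close>
    have low: "count C (k - 1) = 0" if eq: "count C k = nat (a - 1)"
    proof (rule ccontr)
      assume "count C (k - 1) \<noteq> 0"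
      hence "k - 1 \<in># D" by (simp add: D_def not_in_iff)
      then obtain D' where D': "D = add_mset (k - 1) D'" by (auto dest: multi_member_split)
      have "mset_value (add_mset (k + 1) D') = mset_value (add_mset k C)"
        using powi_add_1[of k] a_ge_1 val_C eq D' by (simp add: algebra_simps)
      moreover have "size (add_mset (k + 1) D') \<le> size (add_mset k C)"
        using size_C D' by simp
      ultimately show False using no_carry[of D'] kC by (simp add: R_def)
    qed
    have "greedy_poly a (digits (add_mset k C))"
      unfolding greedy_poly_def
    proof (intro conjI allI)
      show "finite (supp (digits (add_mset k C)))" by (simp add: supp_digits)
    next
      fix i
      have "int (count C i) \<le> a" "int (count C i) = a \<Longrightarrow> count C (i - 1) = 0"
        using greedy_polyD(3,4)[OF C(1), of i] by (auto simp: digits_def)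
      \<comment> \<open>Raising digit \<open>k\<close> also touches the condition at
        \<open>k + 1\<close>, where \<open>k\<close> is the lower neighbour; that digit is 0, hence
        not \<open>a\<close>.\<close>
      moreover have "count C (k + 1) = 0" using C_le[of "k + 1"] not_in_iff by fastforce
      ultimately show "digits (add_mset k C) i \<in> {0..a}"
        "digits (add_mset k C) i = a \<longrightarrow> digits (add_mset k C) (i - 1) = 0"
        using digit_k \<open>count C k \<noteq> nat a\<close> low a_ge_1 by (auto simp: digits_def)
    qed
    thus ?thesis using kC by (auto simp: R_def)
  qed
qed

text \<open>Multiplying by a large even power \<open>\<theta> ^ (2 * n)\<close> makes the conjugate negligible, and then both
  coordinates with respect to the basis \<open>1, \<theta>\<close> are positive.\<close>

lemma Z_adjoin_pos_mset:
  assumes "\<alpha> \<in> Z_adjoin \<theta>" "\<alpha> > 0"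
  obtains M where "mset_value M = \<alpha>"
proof -
  \<comment> \<open>The factor \<theta>^2 leaves room for the combination that isolates
    \<open>v\<close> below.\<close>
  obtain n where n: "\<bar>gconj \<alpha>\<bar> * \<theta>\<^sup>2 / \<alpha> < \<theta> ^ n" using real_arch_pow[OF \<theta>_gt_1] by blast
  define \<beta> where "\<beta> = \<alpha> * \<theta> ^ (2 * n)"
  have "\<beta> \<in> Z_adjoin \<theta>"
    unfolding \<beta>_def by (intro Z_adjoin_mult Z_adjoin_power Z_adjoin_\<theta> assms(1))
  then obtain v u where uv: "\<beta> = of_int v + of_int u * \<theta>" "gconj \<beta> = of_int v + of_int u * \<theta>'"
    by (rule Z_adjoin_cases)
  have "gconj \<beta> = gconj \<alpha> * \<theta>' ^ (2 * n)"
    unfolding \<beta>_def using assms(1)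
    by (simp add: gconj_mult gconj_power gconj_\<theta> quad_field_power Z_adjoin_quad_field Z_adjoin_\<theta>)
  hence "\<bar>gconj \<beta>\<bar> = \<bar>gconj \<alpha>\<bar> * (1 / \<theta>) ^ (2 * n)"
    using \<theta>_gt_1 by (simp add: \<theta>'_eq abs_mult power_abs)
  also have "\<dots> \<le> \<bar>gconj \<alpha>\<bar> * 1"
    using \<theta>_gt_1 by (intro mult_left_mono power_le_one) auto
  finally have conj_le: "\<bar>gconj \<beta>\<bar> \<le> \<bar>gconj \<alpha>\<bar>" by simp
  have "\<bar>gconj \<alpha>\<bar> * \<theta>\<^sup>2 < \<alpha> * \<theta> ^ n" using n assms(2) by (simp add: field_simps)
  also have "\<dots> \<le> \<beta>"
    unfolding \<beta>_def using \<theta>_gt_1 assms(2) by (intro mult_left_mono power_increasing) auto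
  finally have big: "\<bar>gconj \<alpha>\<bar> * \<theta>\<^sup>2 < \<beta>" .
  have conj_bound: "\<bar>gconj \<beta>\<bar> * \<theta>\<^sup>2 < \<beta>"
    using mult_right_mono[OF conj_le, of "\<theta>\<^sup>2"] big by simp
  have "\<bar>gconj \<beta>\<bar> * 1 \<le> \<bar>gconj \<beta>\<bar> * \<theta>\<^sup>2"
    using \<theta>_gt_1 by (intro mult_left_mono) auto
  hence "0 < \<beta> - gconj \<beta>" using conj_bound by linarith
  also have "\<beta> - gconj \<beta> = of_int u * (\<theta> + 1 / \<theta>)"
    using uv by (simp add: \<theta>'_eq algebra_simps)
  finally have "u > 0"
    using zero_less_mult_pos2[of "of_int u" "\<theta> + 1 / \<theta>"] \<theta>_gt_1 by (simp add: add_pos_pos)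
  have "- gconj \<beta> * \<theta>\<^sup>2 \<le> \<bar>gconj \<beta>\<bar> * \<theta>\<^sup>2" by (intro mult_right_mono) auto
  hence "0 < \<beta> + gconj \<beta> * \<theta>\<^sup>2" using conj_bound by linarith
  \<comment> \<open>Since \<theta>' \<theta>^2 = -\<theta>, the contributions of \<open>u\<close>
    cancel.\<close>
  also have "\<beta> + gconj \<beta> * \<theta>\<^sup>2 = of_int v * (1 + \<theta>\<^sup>2)"
    unfolding uv(2) unfolding uv(1) \<theta>'_eq
    using \<theta>_gt_1 by (simp add: algebra_simps power2_eq_square)
  finally have "v > 0"
    using zero_less_mult_pos2[of "of_int v" "1 + \<theta>\<^sup>2"] by (simp add: add_pos_nonneg)
  define k where "k = - int (2 * n)"
  have "\<alpha> = \<beta> * \<theta> powi k"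
    using \<theta>_gt_1 unfolding \<beta>_def k_def power_int_minus power_int_of_nat by simp
  also have "\<dots> = of_int v * \<theta> powi k + of_int u * \<theta> powi (k + 1)"
    using uv(1) \<theta>_gt_1 by (simp add: power_int_add algebra_simps)
  also have "\<dots> = mset_value (replicate_mset (nat v) k + replicate_mset (nat u) (k + 1))"
    using \<open>u > 0\<close> \<open>v > 0\<close> by simp
  finally show ?thesis using that by metis
qed

lemma greedy_expands_exists:
  assumes "\<alpha> \<in> Z_adjoin \<theta>" "\<alpha> > 0"
  obtains b where "greedy_expands a \<theta> b \<alpha>"
proof -
  obtain M where "mset_value M = \<alpha>" using Z_adjoin_pos_mset[OF assms] .
  thus ?thesis
    using greedy_mset_exists[of M "size M"] that unfolding greedy_expands_def
    by (metis eval_poly_digits order_refl)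
qed

end

subsection \<open>The absolute value and the completion\<close>

lemma seq_class_coset: "seq_class a \<theta> f = {\<lambda>n. h n + f n | h. h \<in> null_seqs a \<theta>}"
  by (auto simp: seq_class_def a_r_coset_def' cauchy_ring_def)

lemma seq_classI: "h \<in> null_seqs a \<theta> \<Longrightarrow> (\<lambda>n. h n + f n) \<in> seq_class a \<theta> f"
  by (auto simp: seq_class_coset)

context quadratic_unit
begin

lemma theta_abs_nonneg: "theta_abs a \<theta> x \<ge> 0"
  using \<theta>_gt_1 by (simp add: theta_abs_def)

text \<open>The value 1 acts as a threshold: any element of absolute value below 1 lies in
  \<open>Z_adjoin \<theta>\<close>.\<close>

lemma theta_abs_outside:
  assumes "x \<notin> Z_adjoin \<theta>"
  shows "theta_abs a \<theta> x = 1"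
proof -
  have "\<bar>x\<bar> \<notin> Z_adjoin \<theta>"
    using assms Z_adjoin_uminus[of "- x"] by (auto simp: abs_if split: if_splits)
  hence "\<not> (\<exists>b. greedy_expands a \<theta> b \<bar>x\<bar>)"
    unfolding greedy_expands_def using eval_poly_Z_adjoin by metis
  moreover have "x \<noteq> 0" using assms Z_adjoin_Ints[of 0] by auto
  ultimately show ?thesis by (simp add: theta_abs_def)
qed

text \<open>With lowest exponent \<open>m\<close>, the conjugate lies between
  \<open>\<theta> powi (- m - 1)\<close> and \<open>\<theta> powi (1 - m)\<close> in size, hence one
  factor \<theta> on either side. Existence of the expansion excludes the default value 1.\<close>

lemma theta_abs_conj:
  assumes "x \<in> Z_adjoin \<theta>"
  shows "theta_abs a \<theta> x \<le> \<theta> * \<bar>gconj x\<bar>" and "\<bar>gconj x\<bar> \<le> \<theta> * theta_abs a \<theta> x"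
proof -
  have "theta_abs a \<theta> x \<le> \<theta> * \<bar>gconj x\<bar> \<and> \<bar>gconj x\<bar> \<le> \<theta> * theta_abs a \<theta> x"
  proof (cases "x = 0")
    case True
    thus ?thesis by (simp add: theta_abs_def gconj_Rats)
  next
    case False
    have "\<bar>x\<bar> \<in> Z_adjoin \<theta>" using assms Z_adjoin_uminus by (auto simp: abs_if)
    moreover have "\<bar>x\<bar> > 0" using False by simp
    ultimately obtain b where b: "greedy_expands a \<theta> b \<bar>x\<bar>" by (rule greedy_expands_exists)
    hence greedy: "greedy_poly a b" and eval: "eval_poly \<theta> b = \<bar>x\<bar>"
      by (auto simp: greedy_expands_def)
    have conj: "\<bar>gconj x\<bar> = \<bar>eval_poly \<theta>' b\<bar>"
      unfolding gconj_eval_poly[symmetric] eval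
      using gconj_uminus[OF Z_adjoin_quad_field[OF assms]] by (simp add: abs_if)
    define m where "m = Min (supp b)"
    have "supp b \<noteq> {}" using eval False by (auto simp: eval_poly_def)
    hence "m \<in> supp b" unfolding m_def using greedy_polyD(1)[OF greedy] by (intro Min_in)
    hence bm: "b m \<noteq> 0" by (simp add: supp_def)
    have low: "b i = 0" if "i < m" for i
    proof (rule ccontr)
      assume "b i \<noteq> 0"
      hence "m \<le> i" unfolding m_def using greedy_polyD(1)[OF greedy]
        by (intro Min_le) (auto simp: supp_def)
      thus False using that by simp
    qed
    have abs_eq: "theta_abs a \<theta> x = \<theta> powi (- m)"
      using False b greedy_expansion_eqI[OF b] by (auto simp: theta_abs_def m_def)
    have "\<theta> powi (1 - m) = \<theta> * \<theta> powi (- m)" "\<theta> powi (- m) = \<theta> * \<theta> powi (- m - 1)"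
      using \<theta>_gt_1 by (simp_all add: power_int_diff power_int_minus field_simps)
    moreover have "\<theta> * \<theta> powi (- m - 1) \<le> \<theta> * \<bar>eval_poly \<theta>' b\<bar>"
      using abs_conj_eval_greater[OF greedy low bm] \<theta>_gt_1 by (intro mult_left_mono) auto
    moreover have "\<bar>eval_poly \<theta>' b\<bar> < \<theta> powi (1 - m)"
      using abs_conj_eval_less[OF greedy low] .
    ultimately show ?thesis unfolding conj abs_eq by simp
  qed
  thus "theta_abs a \<theta> x \<le> \<theta> * \<bar>gconj x\<bar>" "\<bar>gconj x\<bar> \<le> \<theta> * theta_abs a \<theta> x" by auto
qed

lemma cauchy_seqsI:
  assumes "\<And>n. f n \<in> ring_of_integers \<theta>" "\<forall>\<^sub>F n in sequentially. f n \<in> Z_adjoin \<theta>"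
    and "Cauchy (\<lambda>n. gconj (f n))"
  shows "f \<in> cauchy_seqs a \<theta>"
  unfolding cauchy_seqs_def
proof (intro CollectI conjI allI impI)
  fix e :: real assume "e > 0"
  hence "e / \<theta> > 0" using \<theta>_gt_1 by simp
  then obtain N where N: "\<And>m n. m \<ge> N \<Longrightarrow> n \<ge> N \<Longrightarrow> \<bar>gconj (f m) - gconj (f n)\<bar> < e / \<theta>"
    using assms(3) unfolding Cauchy_def dist_real_def by blast
  obtain N' where N': "\<And>n. n \<ge> N' \<Longrightarrow> f n \<in> Z_adjoin \<theta>"
    using assms(2) by (auto simp: eventually_sequentially)
  have "theta_abs a \<theta> (f m - f n) < e" if "m \<ge> max N N'" "n \<ge> max N N'" for m n
  proof -
    have mem: "f m \<in> Z_adjoin \<theta>" "f n \<in> Z_adjoin \<theta>" using that N' by auto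
    have "theta_abs a \<theta> (f m - f n) \<le> \<theta> * \<bar>gconj (f m - f n)\<bar>"
      by (intro theta_abs_conj Z_adjoin_diff mem)
    also have "gconj (f m - f n) = gconj (f m) - gconj (f n)"
      using mem by (intro gconj_diff Z_adjoin_quad_field)
    also have "\<theta> * \<bar>gconj (f m) - gconj (f n)\<bar> < \<theta> * (e / \<theta>)"
      using N[of m n] that \<theta>_gt_1 by (intro mult_strict_left_mono) auto
    finally show ?thesis using \<theta>_gt_1 by simp
  qed
  thus "\<exists>N. \<forall>m\<ge>N. \<forall>n\<ge>N. theta_abs a \<theta> (f m - f n) < e" by blast
qed (fact assms(1))

lemma null_seqs_iff:
  assumes "\<And>n. f n \<in> ring_of_integers \<theta>"
  shows "f \<in> null_seqs a \<theta> \<longleftrightarrow>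
    (\<forall>\<^sub>F n in sequentially. f n \<in> Z_adjoin \<theta>) \<and> (\<lambda>n. gconj (f n)) \<longlonglongrightarrow> 0"
proof
  assume "f \<in> null_seqs a \<theta>"
  hence lim: "(\<lambda>n. theta_abs a \<theta> (f n)) \<longlonglongrightarrow> 0" by (simp add: null_seqs_def)
  have "\<forall>\<^sub>F n in sequentially. theta_abs a \<theta> (f n) < 1"
    by (rule order_tendstoD(2)[OF lim]) simp
  hence ev: "\<forall>\<^sub>F n in sequentially. f n \<in> Z_adjoin \<theta>"
    by (rule eventually_mono) (use theta_abs_outside in force)
  have "\<forall>\<^sub>F n in sequentially. norm (gconj (f n)) \<le> norm (theta_abs a \<theta> (f n)) * \<theta>"
    using ev by (rule eventually_mono)
      (use theta_abs_conj(2) theta_abs_nonneg in \<open>simp add: mult.commute\<close>)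
  hence "(\<lambda>n. gconj (f n)) \<longlonglongrightarrow> 0" by (rule tendsto_0_le[OF lim])
  with ev show "(\<forall>\<^sub>F n in sequentially. f n \<in> Z_adjoin \<theta>) \<and> (\<lambda>n. gconj (f n)) \<longlonglongrightarrow> 0" ..
next
  assume *: "(\<forall>\<^sub>F n in sequentially. f n \<in> Z_adjoin \<theta>) \<and> (\<lambda>n. gconj (f n)) \<longlonglongrightarrow> 0"
  have "\<forall>\<^sub>F n in sequentially. norm (theta_abs a \<theta> (f n)) \<le> norm (gconj (f n)) * \<theta>"
    using conjunct1[OF *] by (rule eventually_mono)
      (use theta_abs_conj(1) theta_abs_nonneg in \<open>simp add: mult.commute\<close>)
  hence "(\<lambda>n. theta_abs a \<theta> (f n)) \<longlonglongrightarrow> 0" by (rule tendsto_0_le[OF conjunct2[OF *]])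
  moreover have "f \<in> cauchy_seqs a \<theta>"
    using * assms by (intro cauchy_seqsI) (auto intro: LIMSEQ_imp_Cauchy)
  ultimately show "f \<in> null_seqs a \<theta>" by (simp add: null_seqs_def)
qed

lemma null_seqs_ring_of_integers: "f \<in> null_seqs a \<theta> \<Longrightarrow> f n \<in> ring_of_integers \<theta>"
  by (simp add: null_seqs_def cauchy_seqs_def)

lemma null_seqs_iff_Z_adjoin:
  assumes "\<And>n. f n \<in> Z_adjoin \<theta>"
  shows "f \<in> null_seqs a \<theta> \<longleftrightarrow> (\<lambda>n. gconj (f n)) \<longlonglongrightarrow> 0"
  using assms by (subst null_seqs_iff) (auto intro: Z_adjoin_ring_of_integers)

text \<open>The asymmetry is intended: \<open>h\<close> is an arbitrary member of the ideal, in
  \<open>Z_adjoin \<theta>\<close> only eventually, while \<open>d\<close> will be a difference of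
  two concrete representatives.\<close>

lemma null_seqs_add:
  assumes h: "h \<in> null_seqs a \<theta>" and d: "d \<in> null_seqs a \<theta>" "\<And>n. d n \<in> Z_adjoin \<theta>"
  shows "(\<lambda>n. h n + d n) \<in> null_seqs a \<theta>"
proof (subst null_seqs_iff)
  fix n show "h n + d n \<in> ring_of_integers \<theta>"
    using null_seqs_ring_of_integers[OF h] d(2) by (rule ring_of_integers_add_Z_adjoin)
next
  have h': "\<forall>\<^sub>F n in sequentially. h n \<in> Z_adjoin \<theta>" "(\<lambda>n. gconj (h n)) \<longlonglongrightarrow> 0"
    using h null_seqs_iff[OF null_seqs_ring_of_integers[OF h]] by auto
  have "(\<lambda>n. gconj (h n) + gconj (d n)) \<longlonglongrightarrow> 0 + 0"
    using d by (intro tendsto_add h') (simp add: null_seqs_iff_Z_adjoin)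
  moreover have "\<forall>\<^sub>F n in sequentially. gconj (h n) + gconj (d n) = gconj (h n + d n)"
    using h'(1) by (rule eventually_mono) (use d(2) in \<open>simp add: gconj_add Z_adjoin_quad_field\<close>)
  ultimately have "(\<lambda>n. gconj (h n + d n)) \<longlonglongrightarrow> 0" using tendsto_cong by fastforce
  moreover have "\<forall>\<^sub>F n in sequentially. h n + d n \<in> Z_adjoin \<theta>"
    using h'(1) by (rule eventually_mono) (use d(2) in \<open>simp add: Z_adjoin_add\<close>)
  ultimately show "(\<forall>\<^sub>F n in sequentially. h n + d n \<in> Z_adjoin \<theta>) \<and>
    (\<lambda>n. gconj (h n + d n)) \<longlonglongrightarrow> 0" by simp
qed

section \<open>Equality of classes as a limit of conjugates\<close>

lemma seq_class_mono:
  assumes "\<And>n. f n - g n \<in> Z_adjoin \<theta>" "(\<lambda>n. gconj (f n - g n)) \<longlonglongrightarrow> 0"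
  shows "seq_class a \<theta> f \<subseteq> seq_class a \<theta> g"
proof
  fix k assume "k \<in> seq_class a \<theta> f"
  then obtain h where h: "h \<in> null_seqs a \<theta>" "k = (\<lambda>n. h n + f n)"
    by (auto simp: seq_class_coset)
  have "(\<lambda>n. h n + (f n - g n)) \<in> null_seqs a \<theta>"
    using assms by (intro null_seqs_add h) (simp_all add: null_seqs_iff_Z_adjoin)
  from seq_classI[OF this, of g] show "k \<in> seq_class a \<theta> g" using h(2) by simp
qed

text \<open>The zero sequence is null, so a class contains its representative; equal classes thus
  exhibit \<open>f - g\<close> as a null sequence. The converse is the inclusion used in both
  directions.\<close>

lemma seq_class_eq_iff:
  assumes "\<And>n. f n - g n \<in> Z_adjoin \<theta>"
  shows "seq_class a \<theta> f = seq_class a \<theta> g \<longleftrightarrow> (\<lambda>n. gconj (f n - g n)) \<longlonglongrightarrow> 0"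
proof
  assume eq: "seq_class a \<theta> f = seq_class a \<theta> g"
  have "(\<lambda>_. 0) \<in> null_seqs a \<theta>"
    by (subst null_seqs_iff_Z_adjoin) (auto simp: Z_adjoin_Ints gconj_Rats)
  from seq_classI[OF this, of f] have "f \<in> seq_class a \<theta> f" by simp
  then obtain h where h: "h \<in> null_seqs a \<theta>" "f = (\<lambda>n. h n + g n)"
    unfolding eq by (auto simp: seq_class_coset)
  have "h = (\<lambda>n. f n - g n)" using h(2) by simp
  with h(1) have "(\<lambda>n. f n - g n) \<in> null_seqs a \<theta>" by simp
  thus "(\<lambda>n. gconj (f n - g n)) \<longlonglongrightarrow> 0" using assms by (simp add: null_seqs_iff_Z_adjoin)
next
  assume lim: "(\<lambda>n. gconj (f n - g n)) \<longlonglongrightarrow> 0"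
  have "g n - f n \<in> Z_adjoin \<theta>" "gconj (g n - f n) = - gconj (f n - g n)" for n
    using Z_adjoin_uminus[OF assms[of n]] gconj_uminus[OF Z_adjoin_quad_field[OF assms[of n]]]
    by simp_all
  thus "seq_class a \<theta> f = seq_class a \<theta> g"
    using seq_class_mono[OF assms lim] seq_class_mono[of g f] tendsto_minus[OF lim] by auto
qed

subsection \<open>Sequences of partial sums\<close>

lemma O_plus_digits:
  assumes "x \<in> O_plus a"
  shows "0 \<le> x i" "x i \<le> a" "x i = a \<Longrightarrow> x (i - 1) = 0" "greedy_poly a (truncate n x)"
proof -
  have *: "greedy_poly a (truncate M x)" for M using assms by (simp add: O_plus_def)
  show "0 \<le> x i" "x i \<le> a" "x i = a \<Longrightarrow> x (i - 1) = 0"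
    using greedy_polyD(2,3,4)[OF *[of i], of i] by (simp_all add: truncate_def)
qed (use assms in \<open>simp add: O_plus_def\<close>)

lemma truncate_conj_diff:
  assumes "x \<in> O_plus a" "K \<le> M"
  shows "\<bar>eval_poly \<theta>' (truncate M x) - eval_poly \<theta>' (truncate K x)\<bar> \<le> \<theta> powi (- K)"
proof -
  define y where "y = (\<lambda>i. if K < i then truncate M x i else 0)"
  have y: "greedy_poly a y"
    unfolding greedy_poly_def
  proof (intro conjI allI)
    have "supp y \<subseteq> supp (truncate M x)" by (auto simp: supp_def y_def)
    thus "finite (supp y)" using greedy_polyD(1)[OF O_plus_digits(4)[OF assms(1)]] finite_subset by blast
  qed (use O_plus_digits[OF assms(1)] a_ge_1 in \<open>auto simp: y_def truncate_def\<close>)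
  have "truncate M x = (\<lambda>i. truncate K x i + y i)" using assms(2) by (auto simp: y_def truncate_def)
  hence "eval_poly \<theta>' (truncate M x) = eval_poly \<theta>' (truncate K x) + eval_poly \<theta>' y"
    using eval_poly_add[OF greedy_polyD(1)[OF O_plus_digits(4)[OF assms(1)]] greedy_polyD(1)[OF y]]
    by simp
  moreover have "\<bar>eval_poly \<theta>' y\<bar> < \<theta> powi (1 - (K + 1))"
    by (rule abs_conj_eval_less[OF y]) (simp add: y_def)
  ultimately show ?thesis by simp
qed

lemma partial_sum_seq_Z_adjoin: "partial_sum_seq a \<theta> x f \<Longrightarrow> f n \<in> Z_adjoin \<theta>"
  unfolding partial_sum_seq_def using Z_adjoin_add eval_poly_Z_adjoin by metis

text \<open>One sequence of partial sums must exist for the description in \<open>proj_plus\<close>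
  to determine a class; without one, every \<open>c\<close> would satisfy it vacuously.\<close>

lemma partial_sum_seq_truncate: "partial_sum_seq a \<theta> x (\<lambda>n. eval_poly \<theta> (truncate (int n) x))"
  unfolding partial_sum_seq_def
proof (intro conjI allI exI[of _ int])
  have "greedy_poly a (\<lambda>_. 0)" "eval_poly \<theta> (\<lambda>_. 0) = 0"
    using a_ge_1 by (auto simp: greedy_poly_def supp_def eval_poly_def)
  thus "\<exists>d. greedy_poly a d \<and> (\<forall>j\<le>int n. d j = 0) \<and>
      eval_poly \<theta> (truncate (int n) x) = eval_poly \<theta> (truncate (int n) x) + eval_poly \<theta> d" for n
    by (intro exI[of _ "\<lambda>_. 0"]) simp
qed (auto simp: Z_adjoin_ring_of_integers eval_poly_Z_adjoin mono_def filterlim_int_sequentially)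

text \<open>One \<open>\<theta> powi (- K)\<close> pays for the digits of \<open>x\<close> between
  \<open>K\<close> and \<open>M n\<close>, the other for the correction polynomial
  \<open>d\<close>.\<close>

lemma partial_sum_seq_conj_close:
  assumes x: "x \<in> O_plus a" and f: "partial_sum_seq a \<theta> x f"
  shows "\<forall>\<^sub>F n in sequentially. \<bar>gconj (f n) - eval_poly \<theta>' (truncate K x)\<bar> \<le> 2 * \<theta> powi (- K)"
proof -
  obtain M :: "nat \<Rightarrow> int" where M: "filterlim M at_top sequentially"
    "\<And>n. \<exists>d. greedy_poly a d \<and> (\<forall>j\<le>M n. d j = 0) \<and>
      f n = eval_poly \<theta> (truncate (M n) x) + eval_poly \<theta> d"
    using f unfolding partial_sum_seq_def by blast
  have "\<forall>\<^sub>F n in sequentially. K \<le> M n" using M(1) by (simp add: filterlim_at_top)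
  thus ?thesis
  proof (rule eventually_mono)
    fix n assume "K \<le> M n"
    obtain d where d: "greedy_poly a d" "\<And>j. j \<le> M n \<Longrightarrow> d j = 0"
      "f n = eval_poly \<theta> (truncate (M n) x) + eval_poly \<theta> d" using M(2)[of n] by blast
    have "gconj (f n) = eval_poly \<theta>' (truncate (M n) x) + eval_poly \<theta>' d"
      unfolding d(3) by (simp add: gconj_add Z_adjoin_quad_field eval_poly_Z_adjoin gconj_eval_poly)
    moreover have "\<bar>eval_poly \<theta>' d\<bar> < \<theta> powi (1 - (K + 1))"
      using d(2) \<open>K \<le> M n\<close> by (intro abs_conj_eval_less[OF d(1)]) auto
    ultimately show "\<bar>gconj (f n) - eval_poly \<theta>' (truncate K x)\<bar> \<le> 2 * \<theta> powi (- K)"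
      using truncate_conj_diff[OF x \<open>K \<le> M n\<close>] by simp
  qed
qed

lemma powi_arbitrarily_small:
  assumes "e > 0"
  obtains K where "\<theta> powi (- K) < e"
proof -
  obtain n where "1 / e < \<theta> ^ n" using real_arch_pow[OF \<theta>_gt_1] by blast
  hence "1 < e * \<theta> ^ n" using assms by (simp add: field_simps)
  hence "\<theta> powi (- int n) < e"
    using \<theta>_gt_1 unfolding power_int_minus power_int_of_nat by (simp add: field_simps)
  thus ?thesis using that by blast
qed

text \<open>Independent indices serve two purposes: \<open>f = g\<close> yields the Cauchy property,
  \<open>m = n\<close> the independence of the class from the sequence.\<close>

lemma partial_sum_seq_conj_diff:
  assumes x: "x \<in> O_plus a" and f: "partial_sum_seq a \<theta> x f" and g: "partial_sum_seq a \<theta> x g"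
    and "e > 0"
  obtains N where "\<And>m n. m \<ge> N \<Longrightarrow> n \<ge> N \<Longrightarrow> \<bar>gconj (f m) - gconj (g n)\<bar> < e"
proof -
  \<comment> \<open>Both sequences stay within \<open>2 * \<theta> powi (- K)\<close> of the same
    truncation, hence the quarter.\<close>
  obtain K where K: "\<theta> powi (- K) < e / 4" using powi_arbitrarily_small[of "e / 4"] \<open>e > 0\<close> by auto
  obtain N N' where N:
    "\<And>n. n \<ge> N \<Longrightarrow> \<bar>gconj (f n) - eval_poly \<theta>' (truncate K x)\<bar> \<le> 2 * \<theta> powi (- K)"
    "\<And>n. n \<ge> N' \<Longrightarrow> \<bar>gconj (g n) - eval_poly \<theta>' (truncate K x)\<bar> \<le> 2 * \<theta> powi (- K)"
    using partial_sum_seq_conj_close[OF x f, of K] partial_sum_seq_conj_close[OF x g, of K]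
    unfolding eventually_sequentially by blast
  have "\<bar>gconj (f m) - gconj (g n)\<bar> < e" if "m \<ge> max N N'" "n \<ge> max N N'" for m n
    using N(1)[of m] N(2)[of n] that K by linarith
  thus ?thesis using that by blast
qed

lemma partial_sum_seq_cauchy:
  assumes "x \<in> O_plus a" "partial_sum_seq a \<theta> x f"
  shows "f \<in> cauchy_seqs a \<theta>"
proof (rule cauchy_seqsI)
  show "f n \<in> ring_of_integers \<theta>" for n
    using partial_sum_seq_Z_adjoin[OF assms(2)] by (rule Z_adjoin_ring_of_integers)
  show "\<forall>\<^sub>F n in sequentially. f n \<in> Z_adjoin \<theta>"
    using partial_sum_seq_Z_adjoin[OF assms(2)] by simp
  show "Cauchy (\<lambda>n. gconj (f n))"
    unfolding Cauchy_def dist_real_def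
    using partial_sum_seq_conj_diff[OF assms(1) assms(2) assms(2)] by metis
qed

lemma partial_sum_seq_class_unique:
  assumes "x \<in> O_plus a" "partial_sum_seq a \<theta> x f" "partial_sum_seq a \<theta> x g"
  shows "seq_class a \<theta> f = seq_class a \<theta> g"
proof (subst seq_class_eq_iff)
  have mem: "f n \<in> Z_adjoin \<theta>" "g n \<in> Z_adjoin \<theta>" for n
    using assms(2,3) partial_sum_seq_Z_adjoin by auto
  thus "f n - g n \<in> Z_adjoin \<theta>" for n by (intro Z_adjoin_diff)
  have "(\<lambda>n. gconj (f n) - gconj (g n)) \<longlonglongrightarrow> 0"
  proof (rule LIMSEQ_I)
    fix e :: real assume "e > 0"
    obtain N where "\<And>m n. m \<ge> N \<Longrightarrow> n \<ge> N \<Longrightarrow> \<bar>gconj (f m) - gconj (g n)\<bar> < e"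
      using partial_sum_seq_conj_diff[OF assms \<open>e > 0\<close>] by blast
    thus "\<exists>N. \<forall>n\<ge>N. norm (gconj (f n) - gconj (g n) - 0) < e" by auto
  qed
  thus "(\<lambda>n. gconj (f n - g n)) \<longlonglongrightarrow> 0"
    using mem by (simp add: gconj_diff Z_adjoin_quad_field)
qed

lemma proj_O_plus:
  assumes "x \<in> O_plus a"
  shows "proj a \<theta> x = seq_class a \<theta> (\<lambda>n. eval_poly \<theta> (truncate (int n) x))"
proof -
  have "proj_plus a \<theta> x = seq_class a \<theta> (\<lambda>n. eval_poly \<theta> (truncate (int n) x))"
    unfolding proj_plus_def
  proof (rule the_equality)
    show "\<forall>f. partial_sum_seq a \<theta> x f \<longrightarrow> f \<in> cauchy_seqs a \<theta> \<and>
        seq_class a \<theta> f = seq_class a \<theta> (\<lambda>n. eval_poly \<theta> (truncate (int n) x))"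
      using assms partial_sum_seq_cauchy partial_sum_seq_class_unique partial_sum_seq_truncate
      by blast
  qed (use partial_sum_seq_truncate in blast)
  thus ?thesis using assms by (simp add: proj_def)
qed

lemma proj_eq_const_class_iff:
  assumes x: "x \<in> O_plus a" and b: "greedy_expands a \<theta> b \<alpha>"
  shows "proj a \<theta> x = const_class a \<theta> \<alpha> \<longleftrightarrow> x = b"
proof -
  define s where "s n = eval_poly \<theta>' (truncate (int n) x) - eval_poly \<theta>' b" for n
  have greedy: "greedy_poly a b" and \<alpha>: "\<alpha> = eval_poly \<theta> b"
    using b by (auto simp: greedy_expands_def)
  have "proj a \<theta> x = const_class a \<theta> \<alpha> \<longleftrightarrow>
      (\<lambda>n. gconj (eval_poly \<theta> (truncate (int n) x) - \<alpha>)) \<longlonglongrightarrow> 0"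
    unfolding proj_O_plus[OF x] const_class_def \<alpha>
    by (rule seq_class_eq_iff) (intro Z_adjoin_diff eval_poly_Z_adjoin)
  also have "(\<lambda>n. gconj (eval_poly \<theta> (truncate (int n) x) - \<alpha>)) = s"
    unfolding \<alpha> s_def
    by (simp add: gconj_diff Z_adjoin_quad_field eval_poly_Z_adjoin gconj_eval_poly)
  also have "s \<longlonglongrightarrow> 0 \<longleftrightarrow> x = b"
  proof
    assume lim: "s \<longlonglongrightarrow> 0"
    show "x = b"
    proof (rule ccontr)
      assume "x \<noteq> b"
      then obtain c N where c: "c > 0" "\<And>n. n \<ge> N \<Longrightarrow>
          c \<le> \<bar>eval_poly \<theta>' (truncate n x) - eval_poly \<theta>' b\<bar>"
        using conj_eval_gap[OF greedy x] by blast
      obtain N' where N': "\<And>n. n \<ge> N' \<Longrightarrow> norm (s n - 0) < c" using LIMSEQ_D[OF lim c(1)] by blast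
      \<comment> \<open>The gap starts at an integer index, possibly negative, the limit estimate at
        a natural one; this index satisfies both.\<close>
      have "N \<le> int (max N' (nat N))" by linarith
      thus False using N'[of "max N' (nat N)"] c(2)[of "int (max N' (nat N))"] by (simp add: s_def)
    qed
  next
    assume "x = b"
    obtain N where N: "\<And>n. n \<ge> N \<Longrightarrow> truncate n b = b" using truncate_eq_self[OF greedy] by blast
    have "\<forall>n\<ge>nat N. s n = 0" using N \<open>x = b\<close> by (simp add: s_def)
    hence "\<forall>\<^sub>F n in sequentially. s n = 0" unfolding eventually_sequentially by blast
    thus "s \<longlonglongrightarrow> 0" by (rule tendsto_eventually)
  qed
  finally show ?thesis .
qed

end

theorem theorem23:
  fixes a :: int and \<theta> \<alpha> :: real
  assumes "a \<ge> 1" and "\<theta> > 1" and "\<theta>\<^sup>2 = of_int a * \<theta> + 1"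
    and "\<alpha> \<in> ring_of_integers \<theta>" and "\<alpha> \<in> Z_adjoin \<theta>" and "\<alpha> > 0"
  shows "greedy_expands a \<theta> (greedy_expansion a \<theta> \<alpha>) \<alpha> \<and>
    proj a \<theta> (greedy_expansion a \<theta> \<alpha>) = const_class a \<theta> \<alpha> \<and>
    {x \<in> O_plus a. proj a \<theta> x = const_class a \<theta> \<alpha>} = {greedy_expansion a \<theta> \<alpha>} \<and>
    (\<exists>!x. x \<in> {y \<in> O_signed a. proj a \<theta> y = const_class a \<theta> \<alpha>} \<inter> O_plus a)"
proof -
  interpret quadratic_unit a \<theta> by unfold_locales (fact assms)+
  obtain b where b: "greedy_expands a \<theta> b \<alpha>" using assms(5,6) by (rule greedy_expands_exists)
  hence eq: "greedy_expansion a \<theta> \<alpha> = b" by (rule greedy_expansion_eqI)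
  have "b \<in> O_plus a" using b by (auto simp: greedy_expands_def intro: greedy_poly_O_plus)
  thus ?thesis
    unfolding eq using b proj_eq_const_class_iff[OF _ b] by (auto simp: O_signed_def)
qed

end
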